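(* Let $n\ge1$ and let $\chi$ be an irreducible character of the symmetric group $\mathcal{S}_n$. For $\sigma\in\mathcal{S}_n$ with cycle lengths $p_1,\dots,p_k$ (fixed points included, so $p_1+\cdots+p_k=n$) put $T_\sigma=T_{p_1}\cdots T_{p_k}\in\mathbb{C}[Z,\bar Z]$. Then the polynomial $$F_\chi=\sum_{\sigma\in\mathcal{S}_n}\chi(\sigma)\,T_\sigma$$ is (if nonzero) an eigenvector of $L^{(1/2)}$: there is a constant $c$ with $L^{(1/2)}F_\chi=c\,F_\chi$.
   Context: $Z,\bar Z$ are treated as two independent variables (conjugate complex coordinates), and $$L^{(1/2)}=(\bar Z-Z^2)\partial_Z^2+(1-Z\bar Z)\partial_Z\partial_{\bar Z}+(Z-\bar Z^2)\partial_{\bar Z}^2-4\,(Z\partial_Z+\bar Z\partial_{\bar Z}).$$ The polynomials $T_p\in\mathbb{C}[Z,\bar Z]$, $p\in\mathbb{Z}$, are defined by $T_0=3$, $T_1=3Z$, $T_{-1}=3\bar Z$ and $T_{p+2}-3ZT_{p+1}+3\bar ZT_p-T_{p-1}=0$ for all $p\in\mathbb{Z}$ (equivalently, $T_p=z_1^p+z_2^p+z_3^p$ when $|z_i|=1$, $z_1z_2z_3=1$ and $Z=\frac13(z_1+z_2+z_3)$). *)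

theory Defs
  imports
    Complex_Main
    "HOL-Computational_Algebra.Polynomial"
    "HOL-Algebra.Sym_Groups"
    "HOL-Combinatorics.Orbits"
    "Jordan_Normal_Form.VS_Connect"
begin

text \<open>
  The ring \<open>\<complex>[Z, Zbar]\<close> in two independent variables is rendered as \<open>(\<complex>[Z])[Zbar]\<close>:
  the inner polynomial variable is \<open>Z\<close>, the outer one is \<open>Zbar\<close>.
\<close>

type_synonym bipoly = "complex poly poly"

definition Zv :: bipoly where
  "Zv = [:[:0, 1:]:]"

definition Zbar :: bipoly where
  "Zbar = [:0, 1:]"

definition const :: "complex \<Rightarrow> bipoly" where
  "const c = [:[:c:]:]"

definition dZ :: "bipoly \<Rightarrow> bipoly" where
  "dZ F = map_poly pderiv F"

lemma coeff_dZ: "poly.coeff (dZ F) i = pderiv (poly.coeff F i)"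
  by (simp add: dZ_def coeff_map_poly)

definition dZbar :: "bipoly \<Rightarrow> bipoly" where
  "dZbar F = pderiv F"

definition L_half :: "bipoly \<Rightarrow> bipoly" where
  "L_half F =
     (Zbar - Zv ^ 2) * dZ (dZ F)
     + (1 - Zv * Zbar) * dZ (dZbar F)
     + (Zv - Zbar ^ 2) * dZbar (dZbar F)
     - 4 * (Zv * dZ F + Zbar * dZbar F)"

text \<open>
  The recursion is solved upwards for \<open>p \<ge> 2\<close> and downwards for \<open>p \<le> - 2\<close>;
  lemma \<open>T_recurrence\<close> below shows that it then holds for every integer.
\<close>

function T :: "int \<Rightarrow> bipoly" where
  "T p =
     (if p = 0 then 3
      else if p = 1 then 3 * Zv
      else if p = - 1 then 3 * Zbar
      else if p > 1 then 3 * Zv * T (p - 1) - 3 * Zbar * T (p - 2) + T (p - 3)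
      else T (p + 3) - 3 * Zv * T (p + 2) + 3 * Zbar * T (p + 1))"
  by pat_completeness auto
termination
  by (relation "measure (\<lambda>p. nat \<bar>p\<bar>)") auto

declare T.simps [simp del]

lemma T_initial: "T 0 = 3" "T 1 = 3 * Zv" "T (- 1) = 3 * Zbar"
  by (simp_all add: T.simps)

lemma T_recurrence: "T (p + 2) - 3 * Zv * T (p + 1) + 3 * Zbar * T p - T (p - 1) = 0"
proof (cases "p \<ge> 0")
  case True
  then show ?thesis
    using T.simps [of "p + 2"] by (simp add: algebra_simps)
next
  case False
  then show ?thesis
    using T.simps [of "p - 1"] by (simp add: algebra_simps)
qed

text \<open>
  The cycles of \<open>\<sigma>\<close>, fixed points included, correspond to the orbits of \<open>\<sigma>\<close> on \<open>{1..n}\<close>.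
\<close>

definition T_perm :: "nat \<Rightarrow> (nat \<Rightarrow> nat) \<Rightarrow> bipoly" where
  "T_perm n \<sigma> = (\<Prod>C \<in> orbit \<sigma> ` {1..n}. T (int (card C)))"

definition representation :: "nat \<Rightarrow> nat \<Rightarrow> ((nat \<Rightarrow> nat) \<Rightarrow> complex mat) \<Rightarrow> bool" where
  "representation n d \<rho> \<longleftrightarrow> \<rho> \<in> hom (sym_group n) (units_of (ring_mat TYPE(complex) d ()))"

definition irreducible_rep :: "nat \<Rightarrow> nat \<Rightarrow> ((nat \<Rightarrow> nat) \<Rightarrow> complex mat) \<Rightarrow> bool" where
  "irreducible_rep n d \<rho> \<longleftrightarrow>
     representation n d \<rho> \<and> d > 0 \<and>
     (\<forall>W. VectorSpace.subspace class_ring W (module_vec TYPE(complex) d) \<and>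
          (\<forall>\<sigma> \<in> carrier (sym_group n). \<forall>v \<in> W. \<rho> \<sigma> *\<^sub>v v \<in> W)
        \<longrightarrow> W = {0\<^sub>v d} \<or> W = carrier_vec d)"

definition mat_tr :: "complex mat \<Rightarrow> complex" where
  "mat_tr A = (\<Sum>i < dim_row A. A $$ (i, i))"

text \<open>Characters are only constrained on the carrier of the symmetric group.\<close>

definition irreducible_character :: "nat \<Rightarrow> ((nat \<Rightarrow> nat) \<Rightarrow> complex) \<Rightarrow> bool" where
  "irreducible_character n \<chi> \<longleftrightarrow>
     (\<exists>d \<rho>. irreducible_rep n d \<rho> \<and> (\<forall>\<sigma> \<in> carrier (sym_group n). \<chi> \<sigma> = mat_tr (\<rho> \<sigma>)))"

definition F_char :: "nat \<Rightarrow> ((nat \<Rightarrow> nat) \<Rightarrow> complex) \<Rightarrow> bipoly" where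
  "F_char n \<chi> = (\<Sum>\<sigma> \<in> carrier (sym_group n). const (\<chi> \<sigma>) * T_perm n \<sigma>)"

end

theory Submission
  imports Defs "Jordan_Normal_Form.Spectral_Radius"
begin

text \<open>
  Up to a scalar, \<open>L_half\<close> is the Casimir operator of \<open>SU(3)\<close> acting on class functions, with
  \<open>T p\<close> the \<open>p\<close>-th power sum of the eigenvalues.  By the recurrence for \<open>T\<close>, the bilinear form
  \<open>Gam\<close> merges two power sums, \<open>Gam (T p) (T q) = p q (T p T q - 3 T (p + q))\<close>, while
  \<open>L_half (T p)\<close> splits \<open>T p\<close> into the products \<open>T j T (p - j)\<close>.  These are the two effects of a
  transposition on the cycles of \<open>\<sigma>\<close>, and the weights match: \<open>2 L_half\<close> sends \<open>T_perm n \<sigma>\<close> to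
  \<open>(n\<^sup>2 - 9 n) T_perm n \<sigma>\<close> minus \<open>3\<close> times the sum of \<open>T_perm n (\<sigma> \<circ> transpose a b)\<close> over \<open>a \<noteq> b\<close>.
  Moving the transposition onto \<open>\<chi>\<close> and using Schur's lemma for the class sum of transpositions,
  which is central, gives the eigenvalue equation.
\<close>

section \<open>The operator as a second-order differential operator\<close>

text \<open>
  \<open>Gam\<close> is twice the carre du champ of \<open>L_half\<close>, that is, its defect from being a derivation.
\<close>

definition Gam :: "bipoly \<Rightarrow> bipoly \<Rightarrow> bipoly" where
  "Gam F G = 2 * (Zbar - Zv ^ 2) * dZ F * dZ G
     + (1 - Zv * Zbar) * (dZ F * dZbar G + dZbar F * dZ G)
     + 2 * (Zv - Zbar ^ 2) * dZbar F * dZbar G"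

section \<open>Rules of calculus for the two derivatives\<close>

lemma dZ_0 [simp]: "dZ 0 = 0"
  by (simp add: dZ_def)

lemma dZ_pCons [simp]: "dZ (pCons a F) = pCons (pderiv a) (dZ F)"
  by (simp add: dZ_def Polynomial.map_poly_pCons)

lemma dZ_add: "dZ (F + G) = dZ F + dZ G"
  by (rule poly_eqI) (simp add: coeff_dZ pderiv_add)

lemma dZ_diff: "dZ (F - G) = dZ F - dZ G"
  by (rule poly_eqI) (simp add: coeff_dZ pderiv_diff)

lemma dZ_smult: "dZ (Polynomial.smult a F) = Polynomial.smult (pderiv a) F + Polynomial.smult a (dZ F)"
  by (rule poly_eqI) (simp add: coeff_dZ pderiv_mult)

lemma dZ_mult: "dZ (F * G) = dZ F * G + F * dZ G"
  by (induction F) (simp_all add: dZ_add dZ_smult algebra_simps)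

lemma dZbar_add: "dZbar (F + G) = dZbar F + dZbar G"
  by (simp add: dZbar_def pderiv_add)

lemma dZbar_diff: "dZbar (F - G) = dZbar F - dZbar G"
  by (simp add: dZbar_def pderiv_diff)

lemma dZbar_mult: "dZbar (F * G) = dZbar F * G + F * dZbar G"
  by (simp add: dZbar_def pderiv_mult)

text \<open>As a member of \<open>derivs\<close> it brings mixed derivatives into the form
  \<open>dZ (dZbar F)\<close> in which they occur in \<open>L_half\<close>.\<close>

lemma dZbar_dZ: "dZbar (dZ F) = dZ (dZbar F)"
  by (rule poly_eqI) (simp add: dZbar_def coeff_dZ coeff_pderiv pderiv_mult pderiv_of_nat del: of_nat_Suc)

lemma dZ_const [simp]: "dZ (const c) = 0" and dZbar_const [simp]: "dZbar (const c) = 0"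
  by (simp_all add: const_def dZbar_def pderiv_pCons)

lemma const_1: "const 1 = 1"
  by (simp add: const_def one_pCons)

lemma const_add: "const (a + b) = const a + const b"
  by (simp add: const_def)

lemma const_mult: "const (a * b) = const a * const b"
  by (simp add: const_def)

lemma const_of_nat: "const (of_nat n) = of_nat n"
  by (induction n) (simp_all add: const_add const_1, simp add: const_def)

lemma dZ_numeral [simp]: "dZ (numeral k) = 0" and dZbar_numeral [simp]: "dZbar (numeral k) = 0"
  using dZ_const [of "of_nat (numeral k)"] dZbar_const [of "of_nat (numeral k)"]
  unfolding const_of_nat by simp_all

lemma dZ_1 [simp]: "dZ 1 = 0" and dZbar_1 [simp]: "dZbar 1 = 0"
  using dZ_const [of 1] dZbar_const [of 1] unfolding const_1 by simp_all

lemma dZ_Zv [simp]: "dZ Zv = 1" and dZ_Zbar [simp]: "dZ Zbar = 0"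
  and dZbar_Zv [simp]: "dZbar Zv = 0" and dZbar_Zbar [simp]: "dZbar Zbar = 1"
  by (simp_all add: Zv_def Zbar_def dZbar_def pderiv_pCons one_pCons)

lemma dZbar_0 [simp]: "dZbar 0 = 0"
  by (simp add: dZbar_def)

lemmas derivs = dZ_add dZ_diff dZ_mult dZbar_add dZbar_diff dZbar_mult dZbar_dZ

lemma L_half_add: "L_half (F + G) = L_half F + L_half G"
  by (simp add: L_half_def derivs algebra_simps)

lemma L_half_diff: "L_half (F - G) = L_half F - L_half G"
  by (simp add: L_half_def derivs algebra_simps)

text \<open>The first-order part of \<open>L_half\<close> is a derivation, so beyond the two Leibniz
  terms only the cross terms of the second derivatives remain.\<close>

lemma L_half_mult: "L_half (F * G) = L_half F * G + F * L_half G + Gam F G"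
  by (simp add: L_half_def Gam_def derivs power2_eq_square algebra_simps)

lemma L_half_const_mult: "L_half (const c * F) = const c * L_half F"
  by (simp add: L_half_def derivs algebra_simps)

lemma L_half_sum: "L_half (sum f A) = (\<Sum>x\<in>A. L_half (f x))"
  by (induction A rule: infinite_finite_induct) (simp_all add: L_half_add, simp_all add: L_half_def)

lemma Gam_commute: "Gam F G = Gam G F"
  by (simp add: Gam_def algebra_simps)

text \<open>Only first derivatives enter \<open>Gam\<close>, which makes it a derivation in this
  argument and, by \<open>Gam_commute\<close>, in the other.\<close>

lemma Gam_mult: "Gam (F * G) H = F * Gam G H + G * Gam F H"
  by (simp add: Gam_def derivs algebra_simps)

lemma Gam_add: "Gam (F + G) H = Gam F H + Gam G H"
  by (simp add: Gam_def derivs algebra_simps)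

lemma Gam_diff: "Gam (F - G) H = Gam F H - Gam G H"
  by (simp add: Gam_def derivs algebra_simps)

section \<open>Merging and splitting power sums\<close>

lemma T_rec: "T (p + 3) = T 1 * T (p + 2) - T (- 1) * T (p + 1) + T p"
  using T_recurrence [of "p + 1"] by (simp add: T_initial algebra_simps)

lemma T_2: "T 2 = T 1 * T 1 - 2 * T (- 1)"
  using T_rec [of "- 1"] by (simp add: T_initial(1))

lemma T_m2: "T (- 2) = T (- 1) * T (- 1) - 2 * T 1"
  using T_rec [of "- 2"] by (simp add: T_initial(1)) (simp add: algebra_simps add_eq_0_iff)

text \<open>\<open>T 1\<close> and \<open>T (- 1)\<close> stand for the elementary symmetric
  functions e1 and e2 of three numbers with product 1, and these numbers are the characteristic
  roots of the recurrence. Stating it for arbitrary sequences lets an identity in two indices be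
  treated one index at a time.\<close>

definition T_solution :: "(int \<Rightarrow> bipoly) \<Rightarrow> bool" where
  "T_solution f \<longleftrightarrow> (\<forall>p. f (p + 3) = T 1 * f (p + 2) - T (- 1) * f (p + 1) + f p)"

text \<open>Three consecutive zeros propagate upwards by the recurrence, and downwards because
  \<open>f p\<close> occurs in it with coefficient 1. Hence the induction carries a window of three
  values.\<close>

lemma T_solution_zero:
  assumes "T_solution f" "f (- 1) = 0" "f 0 = 0" "f 1 = 0"
  shows "f p = 0"
proof -
  have rec: "f (p + 3) = T 1 * f (p + 2) - T (- 1) * f (p + 1) + f p" for p
    using assms by (simp add: T_solution_def)
  have "f p = 0 \<and> f (p + 1) = 0 \<and> f (p + 2) = 0"
  proof (induction p rule: int_induct [where k = "- 1"])
    case base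
    then show ?case using assms by simp
  next
    case (step1 i)
    then show ?case using rec [of i] by (simp add: add.assoc)
  next
    case (step2 i)
    then show ?case using rec [of "i - 1"] by (simp add: algebra_simps)
  qed
  then show ?thesis ..
qed

lemma T_solution_T: "T_solution T"
  by (simp add: T_solution_def T_rec)

lemma T_solution_shift: "T_solution f \<Longrightarrow> T_solution (\<lambda>p. f (p + k))"
proof (unfold T_solution_def, intro allI)
  fix p
  assume "\<forall>p. f (p + 3) = T 1 * f (p + 2) - T (- 1) * f (p + 1) + f p"
  from spec [OF this, of "p + k"]
  show "f (p + 3 + k) = T 1 * f (p + 2 + k) - T (- 1) * f (p + 1 + k) + f (p + k)"
    by (simp add: add_ac)
qed

lemma T_solution_mult: "T_solution f \<Longrightarrow> T_solution (\<lambda>p. c * f p)"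
  by (simp add: T_solution_def distrib_left right_diff_distrib mult.left_commute)

lemma T_solution_add: "T_solution f \<Longrightarrow> T_solution g \<Longrightarrow> T_solution (\<lambda>p. f p + g p)"
  by (simp add: T_solution_def algebra_simps)

lemma T_solution_diff: "T_solution f \<Longrightarrow> T_solution g \<Longrightarrow> T_solution (\<lambda>p. f p - g p)"
  by (simp add: T_solution_def) (simp add: algebra_simps)

text \<open>
  Both sides solve the recurrence of \<open>T\<close> in \<open>p\<close> and in \<open>q\<close>, so nine initial values decide.
  The identity is what the induction step for \<open>Gam_T\<close> reduces to.
\<close>

lemma T_bilinear:
  "3 * T (p + q + 3) - 2 * T 1 * T (p + q + 2) + T (- 1) * T (p + q + 1)
    = T (q + 1) * T (p + 2) + T (q - 1) * T (p + 1) + (T (p + 3) - T 1 * T (p + 2)) * T q"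
proof -
  define f where "f p q = 3 * T (p + q + 3) - 2 * T 1 * T (p + q + 2) + T (- 1) * T (p + q + 1)
    - (T (q + 1) * T (p + 2) + T (q - 1) * T (p + 1) + (T (p + 3) - T 1 * T (p + 2)) * T q)" for p q
  have shift: "T_solution (\<lambda>p. T (p + k))" for k
    by (intro T_solution_shift T_solution_T)
  have sum_shift: "T_solution (\<lambda>p. T (p + q + k))" "T_solution (\<lambda>q. T (p + q + k))" for p q k
    using shift [of "q + k"] shift [of "p + k"] by (simp_all add: algebra_simps)
  have p: "T_solution (\<lambda>p. f p q)" for q
  proof -
    \<comment> \<open>The constant factor \<open>T q\<close> goes to the left, where
      \<open>T_solution_mult\<close> expects it.\<close>
    have "(\<lambda>p. f p q) = (\<lambda>p. 3 * T (p + q + 3) - 2 * T 1 * T (p + q + 2) + T (- 1) * T (p + q + 1)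
      - (T (q + 1) * T (p + 2) + T (q - 1) * T (p + 1) + T q * (T (p + 3) - T 1 * T (p + 2))))"
      by (simp add: f_def mult.commute [of "T q"])
    then show ?thesis
      by (elim ssubst) (intro T_solution_add T_solution_diff T_solution_mult shift sum_shift)
  qed
  have q: "T_solution (f p)" for p
  proof -
    \<comment> \<open>Writing \<open>q + - 1\<close> turns the index into a shift that matches
      \<open>shift\<close>.\<close>
    have "f p = (\<lambda>q. 3 * T (p + q + 3) - 2 * T 1 * T (p + q + 2) + T (- 1) * T (p + q + 1)
      - (T (p + 2) * T (q + 1) + T (p + 1) * T (q + - 1) + (T (p + 3) - T 1 * T (p + 2)) * T q))"
      by (simp add: f_def fun_eq_iff)
    then show ?thesis
      by (elim ssubst) (intro T_solution_add T_solution_diff T_solution_mult shift sum_shift T_solution_T)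
  qed
  \<comment> \<open>For \<open>p\<close> and \<open>q\<close> in {-1, 0, 1} the indices in
    \<open>f\<close> run from -2 to 5, so these values reduce the nine checks to polynomial
    identities in \<open>T 1\<close> and \<open>T (- 1)\<close>.\<close>
  have 3: "T 3 = T 1 * T 2 - T (-1) * T 1 + 3"
    and 4: "T 4 = T 1 * T 3 - T (-1) * T 2 + T 1" and 5: "T 5 = T 1 * T 4 - T (-1) * T 3 + T 2"
    using T_rec [of 0] T_rec [of 1] T_rec [of 2] by (simp_all add: T_initial(1))
  have base: "f p q = 0" if "p \<in> {-1, 0, 1}" "q \<in> {-1, 0, 1}" for p q
    using that by (auto simp: f_def T_2 T_m2 3 4 5 T_initial(1) algebra_simps)
  \<comment> \<open>First \<open>q\<close> becomes arbitrary while \<open>p\<close> stays an initial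
    value, then \<open>p\<close> is freed as well.\<close>
  have "f p q = 0" if "p \<in> {-1, 0, 1}" for p q
    by (rule T_solution_zero [OF q]) (use base that in auto)
  note this [simp]
  have "f p q = 0"
    by (rule T_solution_zero [OF p]) simp_all
  then show ?thesis
    by (simp add: f_def)
qed

section \<open>Cross terms of two power sums\<close>

lemma L_half_T_1: "L_half (T 1) = - 4 * T 1" and L_half_T_m1: "L_half (T (- 1)) = - 4 * T (- 1)"
  by (simp_all add: L_half_def T_initial derivs)

lemma Gam_numeral: "Gam (numeral k) F = 0" "Gam F (numeral k) = 0"
  by (simp_all add: Gam_def)

lemma Gam_0: "Gam (T 0) F = 0"
  by (simp add: T_initial(1) Gam_def)

text \<open>The defect \<open>D\<close> of the claim solves the recurrence of \<open>T\<close> in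
  its first index and is symmetric, so it vanishes once its values at indices -1, 0 and 1
  do.\<close>

lemma Gam_T: "Gam (T p) (T q) = of_int (p * q) * (T p * T q - 3 * T (p + q))"
proof -
  define D where "D p q = Gam (T p) (T q) - of_int (p * q) * (T p * T q - 3 * T (p + q))" for p q
  have D_sym: "D p q = D q p" for p q
    by (simp add: D_def Gam_commute [of "T p"] algebra_simps)
  \<comment> \<open>The product rule adds terms with \<open>Gam (T 1) (T q)\<close> and
    \<open>Gam (T (- 1)) (T q)\<close> to the recurrence; the two premises supply their
    values.\<close>
  have D_rec: "D (p + 3) q = T 1 * D (p + 2) q - T (- 1) * D (p + 1) q + D p q"
    if "D 1 q = 0" "D (- 1) q = 0" for p q
  proof -
    have G1: "Gam (T 1) (T q) = of_int q * (T 1 * T q - 3 * T (q + 1))"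
      and Gm1: "Gam (T (- 1)) (T q) = - of_int q * (T (- 1) * T q - 3 * T (q - 1))"
      using that by (simp_all add: D_def algebra_simps)
    have G3: "Gam (T (p + 3)) (T q) = T 1 * Gam (T (p + 2)) (T q) + T (p + 2) * Gam (T 1) (T q)
      - T (- 1) * Gam (T (p + 1)) (T q) - T (p + 1) * Gam (T (- 1)) (T q) + Gam (T p) (T q)"
      by (subst T_rec) (simp add: Gam_add Gam_diff Gam_mult algebra_simps)
    have "T (p + q + 3) = T 1 * T (p + q + 2) - T (- 1) * T (p + q + 1) + T (p + q)"
      and "T (p + 3) = T 1 * T (p + 2) - T (- 1) * T (p + 1) + T p"
      using T_rec [of "p + q"] T_rec [of p] by (simp_all add: add.assoc)
    note rec = this
    define X where "X = 3 * T (p + q + 3) - 2 * T 1 * T (p + q + 2) + T (- 1) * T (p + q + 1)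
      - (T (q + 1) * T (p + 2) + T (q - 1) * T (p + 1) + (T (p + 3) - T 1 * T (p + 2)) * T q)"
    have X: "X = 0"
      by (simp add: X_def T_bilinear)
    have args: "p + 3 + q = p + q + 3" "p + 2 + q = p + q + 2" "p + 1 + q = p + q + 1"
      by simp_all
    \<comment> \<open>All that obstructs the recurrence for \<open>D\<close> is a multiple of the
      defect of \<open>T_bilinear\<close>.\<close>
    have "D (p + 3) q - (T 1 * D (p + 2) q - T (- 1) * D (p + 1) q + D p q) = 3 * of_int q * X"
      unfolding D_def args unfolding G3 G1 Gm1 unfolding X_def rec by (simp add: algebra_simps)
    then show ?thesis
      unfolding X by simp
  qed
  have base: "D 1 1 = 0" "D (- 1) 1 = 0" "D 1 (- 1) = 0" "D (- 1) (- 1) = 0" "\<And>q. D 0 q = 0"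
    by (auto simp: D_def Gam_0 Gam_def T_2 T_m2 T_initial derivs power2_eq_square algebra_simps)
  have D_zero: "D p q = 0" if "D 1 q = 0" "D (- 1) q = 0" for p q
  proof (rule T_solution_zero [of "\<lambda>p. D p q"])
    show "T_solution (\<lambda>p. D p q)"
      unfolding T_solution_def using D_rec that by blast
  qed (simp_all add: that base)
  have "D p q = 0"
    \<comment> \<open>One use of \<open>D_zero\<close> reduces \<open>p\<close> to 1 and -1; after
      swapping the indices, a second use does the same for \<open>q\<close>.\<close>
    by (rule D_zero; subst D_sym, rule D_zero) (simp_all add: base)
  then show ?thesis
    by (simp add: D_def)
qed

text \<open>This is the contribution of a cycle of length \<open>p\<close> cut in two, summed over
  the distance \<open>j\<close> between the transposed points.\<close>

definition split_sum :: "nat \<Rightarrow> bipoly" where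
  "split_sum p = (\<Sum>j = 1..<p. T (int j) * T (int (p - j)))"

lemma T_rec_nat: "T (int p + 3) = T 1 * T (int p + 2) - T (- 1) * T (int p + 1) + T (int p)"
  by (rule T_rec)

lemma T_3: "T 3 = T 1 * T 2 - T (- 1) * T 1 + 3"
  using T_rec [of 0] by (simp add: T_initial(1))

text \<open>The recurrence is applied to the second factor alone, with \<open>j\<close> kept below
  \<open>p\<close>; the summands with \<open>j\<close> at least \<open>p\<close> give the
  correction. Its coefficients 3, \<open>- 2 * T (- 1)\<close> and \<open>T 1\<close> are the values
  of \<open>T 3 - T 1 * T 2 + T (- 1) * T 1\<close>, \<open>T 2 - T 1 * T 1\<close> and
  \<open>T 1\<close>.\<close>

lemma split_sum_rec:
  assumes "p \<ge> 1"
  shows "split_sum (p + 3) = T 1 * split_sum (p + 2) - T (- 1) * split_sum (p + 1) + split_sum p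
    + (3 * T (int p) - 2 * T (- 1) * T (int p + 1) + T 1 * T (int p + 2))"
proof -
  \<comment> \<open>\<open>A k\<close> shifts the second index by \<open>k\<close> without extending
    the range of summation.\<close>
  define A where "A k = (\<Sum>j = 1..<p. T (int j) * T (int p - int j + k))" for k
  have "A 3 = (\<Sum>j = 1..<p. T 1 * (T (int j) * T (int p - int j + 2))
    - T (- 1) * (T (int j) * T (int p - int j + 1)) + T (int j) * T (int p - int j + 0))"
    unfolding A_def T_rec by (simp add: algebra_simps)
  then have A: "A 3 = T 1 * A 2 - T (- 1) * A 1 + A 0"
    by (simp add: A_def sum.distrib sum_subtractf sum_distrib_left)
  have S: "split_sum (p + k) = A (int k) + (\<Sum>j = p..<p + k. T (int j) * T (int (p + k - j)))" for k
  proof -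
    have "split_sum (p + k) = (\<Sum>j = 1..<p. T (int j) * T (int (p + k - j)))
      + (\<Sum>j = p..<p + k. T (int j) * T (int (p + k - j)))"
      unfolding split_sum_def using assms by (simp add: sum.atLeastLessThan_concat)
    also have "(\<Sum>j = 1..<p. T (int j) * T (int (p + k - j))) = A (int k)"
      unfolding A_def by (intro sum.cong) (auto simp: of_nat_diff algebra_simps)
    finally show ?thesis .
  qed
  have S3: "split_sum (p + 3) = A 3 + T (int p) * T 3 + T (int p + 1) * T 2 + T (int p + 2) * T 1"
    using S [of 3] by (simp add: numeral_3_eq_3 add_ac)
  have S2: "split_sum (p + 2) = A 2 + T (int p) * T 2 + T (int p + 1) * T 1"
    using S [of 2] by (simp add: numeral_2_eq_2 add_ac)
  have S1: "split_sum (p + 1) = A 1 + T (int p) * T 1" "split_sum p = A 0"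
    using S [of 1] S [of 0] by simp_all
  show ?thesis
    unfolding S3 S2 S1 A T_3 T_2 by (simp add: algebra_simps)
qed

text \<open>\<open>split_sum\<close> lives on the naturals, so in place of
  \<open>T_solution_zero\<close> its identities use a one-sided induction with three starting
  values.\<close>

lemma three_step_induct:
  assumes "p \<ge> (1::nat)" "P 1" "P 2" "P 3" "\<And>p. p \<ge> 1 \<Longrightarrow> P p \<Longrightarrow> P (p + 1) \<Longrightarrow> P (p + 2) \<Longrightarrow> P (p + 3)"
  shows "P p"
proof -
  have "P p \<and> P (p + 1) \<and> P (p + 2)"
    using assms(1)
  proof (induction p rule: nat_induct_at_least)
    case base
    show ?case using assms(2-4) by (simp add: numeral_3_eq_3 numeral_2_eq_2)
  next
    case (Suc n)
    then show ?case using assms(5) [of n] by (simp add: numeral_3_eq_3)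
  qed
  then show ?thesis ..
qed

lemma split_sum_123: "split_sum 1 = 0" "split_sum 2 = T 1 * T 1" "split_sum 3 = 2 * (T 1 * T 2)"
  by (simp_all add: split_sum_def numeral_3_eq_3 numeral_2_eq_2 algebra_simps)

text \<open>The right-hand side is dictated by the induction step for \<open>L_half_T\<close>.\<close>

lemma split_sum_weighted:
  assumes "p \<ge> 1"
  shows "3 * split_sum (p + 3) - 2 * T 1 * split_sum (p + 2) + T (- 1) * split_sum (p + 1)
    = (4 * of_nat p - 2) * T (int p + 3) + (6 - 3 * of_nat p) * T 1 * T (int p + 2)
      + (2 * of_nat p - 6) * T (- 1) * T (int p + 1) + (2 - of_nat p) * T (int p)"
proof -
  define E where "E p = 3 * split_sum (p + 3) - 2 * T 1 * split_sum (p + 2) + T (- 1) * split_sum (p + 1)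
    - ((4 * of_nat p - 2) * T (int p + 3) + (6 - 3 * of_nat p) * T 1 * T (int p + 2)
      + (2 * of_nat p - 6) * T (- 1) * T (int p + 1) + (2 - of_nat p) * T (int p))" for p
  have T456: "T 4 = T 1 * T 3 - T (-1) * T 2 + T 1" "T 5 = T 1 * T 4 - T (-1) * T 3 + T 2"
    "T 6 = T 1 * T 5 - T (-1) * T 4 + T 3"
    using T_rec [of 1] T_rec [of 2] T_rec [of 3] by simp_all
  have S456: "split_sum 4 = T 1 * split_sum 3 - T (- 1) * split_sum 2 + split_sum 1
    + (3 * T 1 - 2 * T (- 1) * T 2 + T 1 * T 3)"
   "split_sum 5 = T 1 * split_sum 4 - T (- 1) * split_sum 3 + split_sum 2
    + (3 * T 2 - 2 * T (- 1) * T 3 + T 1 * T 4)"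
   "split_sum 6 = T 1 * split_sum 5 - T (- 1) * split_sum 4 + split_sum 3
    + (3 * T 3 - 2 * T (- 1) * T 4 + T 1 * T 5)"
    using split_sum_rec [of 1] split_sum_rec [of 2] split_sum_rec [of 3]
    by (simp_all del: One_nat_def)
  have "E p = 0"
  proof (rule three_step_induct [OF assms])
    show "E 1 = 0" "E 2 = 0" "E 3 = 0"
      by (simp_all add: E_def S456 split_sum_123 T456 T_3 T_2 algebra_simps del: One_nat_def)
  next
    fix p :: nat
    assume p: "p \<ge> 1" and E: "E p = 0" "E (p + 1) = 0" "E (p + 2) = 0"
    define t0 t1 t2 where t: "t0 = T (int p)" "t1 = T (int p + 1)" "t2 = T (int p + 2)"
    define s1 s2 s3 where s: "s1 = split_sum (p + 1)" "s2 = split_sum (p + 2)" "s3 = split_sum (p + 3)"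
    have T3: "T (int p + 3) = T 1 * t2 - T (- 1) * t1 + t0"
      unfolding t by (rule T_rec)
    have T4: "T (int p + 4) = T 1 * T (int p + 3) - T (- 1) * t2 + t1"
      using T_rec [of "int p + 1"] unfolding t by (simp add: add.assoc)
    have T5: "T (int p + 5) = T 1 * T (int p + 4) - T (- 1) * T (int p + 3) + t2"
      using T_rec [of "int p + 2"] unfolding t by (simp add: add.assoc)
    have T6: "T (int p + 6) = T 1 * T (int p + 5) - T (- 1) * T (int p + 4) + T (int p + 3)"
      using T_rec [of "int p + 3"] by (simp add: add.assoc)
    have S4: "split_sum (p + 4) = T 1 * s3 - T (- 1) * s2 + s1
      + (3 * t1 - 2 * T (- 1) * t2 + T 1 * T (int p + 3))"
      using split_sum_rec [of "p + 1"] unfolding s t by (simp add: add_ac numeral_eq_Suc)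
    have S5: "split_sum (p + 5) = T 1 * split_sum (p + 4) - T (- 1) * s3 + s2
      + (3 * t2 - 2 * T (- 1) * T (int p + 3) + T 1 * T (int p + 4))"
      using split_sum_rec [of "p + 2"] unfolding s t by (simp add: add_ac numeral_eq_Suc)
    have S6: "split_sum (p + 6) = T 1 * split_sum (p + 5) - T (- 1) * split_sum (p + 4) + s3
      + (3 * T (int p + 3) - 2 * T (- 1) * T (int p + 4) + T 1 * T (int p + 5))"
      using split_sum_rec [of "p + 3"] unfolding s t by (simp add: add_ac numeral_eq_Suc)
    have E0: "E p = 3 * s3 - 2 * T 1 * s2 + T (- 1) * s1
      - ((4 * of_nat p - 2) * T (int p + 3) + (6 - 3 * of_nat p) * T 1 * t2
      + (2 * of_nat p - 6) * T (- 1) * t1 + (2 - of_nat p) * t0)"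
      by (simp add: E_def s t)
    have E1: "E (p + 1) = 3 * split_sum (p + 4) - 2 * T 1 * s3 + T (- 1) * s2
      - ((4 * of_nat p + 2) * T (int p + 4) + (3 - 3 * of_nat p) * T 1 * T (int p + 3)
      + (2 * of_nat p - 4) * T (- 1) * t2 + (1 - of_nat p) * t1)"
      by (simp add: E_def s t add_ac numeral_eq_Suc)
    have E2: "E (p + 2) = 3 * split_sum (p + 5) - 2 * T 1 * split_sum (p + 4) + T (- 1) * s3
      - ((4 * of_nat p + 6) * T (int p + 5) + (- 3 * of_nat p) * T 1 * T (int p + 4)
      + (2 * of_nat p - 2) * T (- 1) * T (int p + 3) + (- of_nat p) * t2)"
      by (simp add: E_def s t add_ac numeral_eq_Suc)
    have E3: "E (p + 3) = 3 * split_sum (p + 6) - 2 * T 1 * split_sum (p + 5) + T (- 1) * split_sum (p + 4)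
      - ((4 * of_nat p + 10) * T (int p + 6) + (- 3 - 3 * of_nat p) * T 1 * T (int p + 5)
      + (2 * of_nat p) * T (- 1) * T (int p + 4) + (- 1 - of_nat p) * T (int p + 3))"
      by (simp add: E_def s t add_ac numeral_eq_Suc)
    \<comment> \<open>The defect \<open>E\<close> solves the homogeneous recurrence. The unfolding
      runs from the highest index down, because each equation introduces lower values that are still
      to be replaced.\<close>
    have "E (p + 3) = T 1 * E (p + 2) - T (- 1) * E (p + 1) + E p"
      unfolding E0 E1 E2 E3
      unfolding S6 unfolding S5 unfolding S4 unfolding T6 unfolding T5 unfolding T4 unfolding T3
      by (simp add: algebra_simps)
    then show "E (p + 3) = 0"
      using E by simp
  qed
  then show ?thesis
    by (simp add: E_def)
qed

text \<open>This is \<open>L_half_mult\<close> applied to the recurrence: \<open>T 1\<close> and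
  \<open>T (- 1)\<close> have eigenvalue -4, and \<open>Gam_T\<close> evaluates the cross
  terms.\<close>

lemma L_half_T_rec: "L_half (T (p + 3)) = T 1 * L_half (T (p + 2)) - T (- 1) * L_half (T (p + 1)) + L_half (T p)
    - 4 * T 1 * T (p + 2) + 4 * T (- 1) * T (p + 1)
    + of_int (p + 2) * (T 1 * T (p + 2) - 3 * T (p + 3)) + of_int (p + 1) * (T (- 1) * T (p + 1) - 3 * T p)"
proof -
  have "Gam (T 1) (T (p + 2)) = of_int (p + 2) * (T 1 * T (p + 2) - 3 * T (p + 3))"
    "Gam (T (- 1)) (T (p + 1)) = - of_int (p + 1) * (T (- 1) * T (p + 1) - 3 * T p)"
    unfolding Gam_T by (simp_all add: algebra_simps)
  moreover have "L_half (T (p + 3)) = L_half (T 1 * T (p + 2)) - L_half (T (- 1) * T (p + 1)) + L_half (T p)"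
    unfolding T_rec by (simp only: L_half_add L_half_diff)
  ultimately show ?thesis
    by (simp only: L_half_mult L_half_T_1 L_half_T_m1) (simp add: algebra_simps)
qed

section \<open>The operator on a single power sum\<close>

lemma L_half_numeral: "L_half (numeral k) = 0"
  by (simp add: L_half_def)

text \<open>Both \<open>L_half (T p)\<close> and \<open>split_sum p\<close> satisfy inhomogeneous
  recurrences. The weight \<open>p\<close> in front of \<open>split_sum\<close> disturbs the second
  one, and \<open>split_sum_weighted\<close> absorbs the disturbance.\<close>

lemma L_half_T:
  assumes "p \<ge> 1"
  shows "2 * L_half (T (int p)) = (of_nat p ^ 2 - 9 * of_nat p) * T (int p) - 3 * of_nat p * split_sum p"
proof (rule three_step_induct [OF assms])
  have L2: "L_half (T 2) = - 7 * T 2 - 3 * (T 1 * T 1)"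
    unfolding T_2 by (simp add: L_half_diff L_half_mult L_half_numeral L_half_T_1 L_half_T_m1 Gam_numeral Gam_T T_2 algebra_simps)
  show "2 * L_half (T (int 1)) = (of_nat 1 ^ 2 - 9 * of_nat 1) * T (int 1) - 3 * of_nat 1 * split_sum 1"
    by (simp add: L_half_T_1 split_sum_123 del: One_nat_def)
  show "2 * L_half (T (int 2)) = (of_nat 2 ^ 2 - 9 * of_nat 2) * T (int 2) - 3 * of_nat 2 * split_sum 2"
    by (simp add: split_sum_123 L2 algebra_simps)
  show "2 * L_half (T (int 3)) = (of_nat 3 ^ 2 - 9 * of_nat 3) * T (int 3) - 3 * of_nat 3 * split_sum 3"
  proof -
    have "L_half (T 3) = - 9 * T 1 * T 2 - 3 * T 1 * T 1 * T 1 + 9 * T (- 1) * T 1 - 6 * T 3 - 9"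
      using L_half_T_rec [of 0]
      by (simp add: L_half_T_1 L2 T_initial(1) L_half_numeral) (simp add: algebra_simps)
    then show ?thesis
      by (simp add: split_sum_123) (simp add: T_3 T_2 algebra_simps)
  qed
next
  fix p :: nat
  assume p: "p \<ge> 1"
    and IH: "2 * L_half (T (int p)) = (of_nat p ^ 2 - 9 * of_nat p) * T (int p) - 3 * of_nat p * split_sum p"
      "2 * L_half (T (int (p + 1))) = (of_nat (p + 1) ^ 2 - 9 * of_nat (p + 1)) * T (int (p + 1)) - 3 * of_nat (p + 1) * split_sum (p + 1)"
      "2 * L_half (T (int (p + 2))) = (of_nat (p + 2) ^ 2 - 9 * of_nat (p + 2)) * T (int (p + 2)) - 3 * of_nat (p + 2) * split_sum (p + 2)"
  define P where "P = (of_nat p :: bipoly)"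
  define R where "R = 3 * split_sum (p + 3) - 2 * T 1 * split_sum (p + 2) + T (- 1) * split_sum (p + 1)
      - ((4 * P - 2) * T (int p + 3) + (6 - 3 * P) * T 1 * T (int p + 2)
      + (2 * P - 6) * T (- 1) * T (int p + 1) + (2 - P) * T (int p))"
  have R: "R = 0"
    unfolding R_def P_def split_sum_weighted [OF p] by simp
  have IH': "2 * L_half (T (int p)) = (P ^ 2 - 9 * P) * T (int p) - 3 * P * split_sum p"
    "2 * L_half (T (int p + 1)) = ((P + 1) ^ 2 - 9 * (P + 1)) * T (int p + 1) - 3 * (P + 1) * split_sum (p + 1)"
    "2 * L_half (T (int p + 2)) = ((P + 2) ^ 2 - 9 * (P + 2)) * T (int p + 2) - 3 * (P + 2) * split_sum (p + 2)"
    using IH unfolding P_def by (simp_all add: add_ac)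
  have "2 * L_half (T (int p + 3)) = T 1 * (2 * L_half (T (int p + 2))) - T (- 1) * (2 * L_half (T (int p + 1))) + 2 * L_half (T (int p))
    - 8 * T 1 * T (int p + 2) + 8 * T (- 1) * T (int p + 1)
    + 2 * (P + 2) * (T 1 * T (int p + 2) - 3 * T (int p + 3)) + 2 * (P + 1) * (T (- 1) * T (int p + 1) - 3 * T (int p))"
    unfolding L_half_T_rec P_def by (simp add: algebra_simps)
  \<comment> \<open>The weights \<open>P + 2\<close>, \<open>P + 1\<close>, \<open>P\<close> from
    the induction hypotheses fall short of \<open>P + 3\<close> by 1, 2, 3; together with the
    inhomogeneous terms the difference is exactly \<open>3 * R\<close>.\<close>
  also have "\<dots> = ((P + 3) ^ 2 - 9 * (P + 3)) * T (int p + 3) - 3 * (P + 3) * split_sum (p + 3) + 3 * R"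
    unfolding IH' R_def unfolding split_sum_rec [OF p] unfolding T_rec_nat
    by (simp add: algebra_simps power2_eq_square)
  finally show "2 * L_half (T (int (p + 3))) = (of_nat (p + 3) ^ 2 - 9 * of_nat (p + 3)) * T (int (p + 3)) - 3 * of_nat (p + 3) * split_sum (p + 3)"
    unfolding R P_def by (simp add: add_ac)
qed

section \<open>Cycles of a permutation times a transposition\<close>

lemma orbit_permutes_eq:
  assumes "\<sigma> permutes {1..n::nat}" "y \<in> orbit \<sigma> x"
  shows "orbit \<sigma> y = orbit \<sigma> x"
  using assms cyclic_on_orbit orbit_cyclic_eq3 finite_atLeastAtMost by metis

lemma self_in_orbit_permutes:
  assumes "\<sigma> permutes {1..n::nat}"
  shows "x \<in> orbit \<sigma> x"
  using assms permutation_permutes permutation_self_in_orbit finite_atLeastAtMost by metis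

lemma orbit_comp_transpose_same:
  assumes \<sigma>: "\<sigma> permutes {1..n::nat}" and "a \<notin> orbit \<sigma> x" "b \<notin> orbit \<sigma> x"
  shows "orbit (\<sigma> \<circ> transpose a b) x = orbit \<sigma> x"
proof (rule orbit_cong)
  show "x \<in> orbit \<sigma> x"
    using \<sigma> by (rule self_in_orbit_permutes)
  show "(\<sigma> \<circ> transpose a b) s = \<sigma> s" if "s \<in> orbit \<sigma> x" for s
    using that assms by (auto simp: transpose_def)
qed

text \<open>The product sends \<open>a\<close> to \<open>\<sigma> b\<close> and from there follows
  \<open>\<sigma>\<close> around the cycle of \<open>b\<close>, which does not contain
  \<open>a\<close>, until it reaches \<open>b\<close>.\<close>

lemma orbit_comp_transpose_subset:
  assumes \<sigma>: "\<sigma> permutes {1..n::nat}" and "b \<notin> orbit \<sigma> a"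
  shows "orbit \<sigma> b \<subseteq> orbit (\<sigma> \<circ> transpose a b) a"
proof
  have a: "a \<notin> orbit \<sigma> b"
    using assms orbit_permutes_eq self_in_orbit_permutes by metis
  have \<sigma>b: "\<sigma> b \<in> orbit (\<sigma> \<circ> transpose a b) a"
    using orbit.base [of "\<sigma> \<circ> transpose a b" a] by (simp only: o_apply transpose_apply_first)
  fix y
  assume "y \<in> orbit \<sigma> b"
  then show "y \<in> orbit (\<sigma> \<circ> transpose a b) a"
  proof induction
    case base
    show ?case by (rule \<sigma>b)
  next
    case (step y)
    show ?case
    proof (cases "y = b")
      case True
      show ?thesis unfolding True by (rule \<sigma>b)
    next
      case False
      moreover have "y \<noteq> a" using step a by auto
      ultimately show ?thesis using orbit.step [OF step.IH] by simp
    qed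
  qed
qed

lemma permutes_comp_transpose:
  assumes "\<sigma> permutes S" "a \<in> S" "b \<in> S"
  shows "(\<sigma> \<circ> transpose a b) permutes S"
  using assms by (intro permutes_compose permutes_swap_id)

text \<open>From \<open>a\<close> the product traverses the cycle of \<open>b\<close>, from
  \<open>b\<close> that of \<open>a\<close>, and it never leaves their union.\<close>

lemma orbit_comp_transpose_merge:
  assumes \<sigma>: "\<sigma> permutes {1..n::nat}" and ab: "a \<in> {1..n}" "b \<in> {1..n}"
    and b: "b \<notin> orbit \<sigma> a" and x: "x \<in> orbit \<sigma> a \<union> orbit \<sigma> b"
  shows "orbit (\<sigma> \<circ> transpose a b) x = orbit \<sigma> a \<union> orbit \<sigma> b"
proof -
  let ?\<tau> = "\<sigma> \<circ> transpose a b"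
  note \<tau> = permutes_comp_transpose [OF \<sigma> ab]
  have a: "a \<notin> orbit \<sigma> b"
    using \<sigma> b orbit_permutes_eq self_in_orbit_permutes by metis
  have bs: "orbit \<sigma> b \<subseteq> orbit ?\<tau> a"
    by (rule orbit_comp_transpose_subset [OF \<sigma> b])
  moreover have as: "orbit \<sigma> a \<subseteq> orbit ?\<tau> b"
    using orbit_comp_transpose_subset [OF \<sigma> a] by (simp add: transpose_commute)
  moreover have eq: "orbit ?\<tau> b = orbit ?\<tau> a"
    using bs self_in_orbit_permutes [OF \<sigma>] by (intro orbit_permutes_eq [OF \<tau>]) auto
  moreover have "orbit ?\<tau> a \<subseteq> orbit \<sigma> a \<union> orbit \<sigma> b"
  proof
    fix y assume "y \<in> orbit ?\<tau> a"
    then show "y \<in> orbit \<sigma> a \<union> orbit \<sigma> b"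
    proof induction
      case base
      then show ?case by (simp add: orbit.base)
    next
      case (step y)
      then show ?case
        by (auto simp: transpose_def intro: orbit.intros)
    qed
  qed
  ultimately have "orbit ?\<tau> a = orbit \<sigma> a \<union> orbit \<sigma> b"
    by auto
  with x show ?thesis
    using orbit_permutes_eq [OF \<tau>] by metis
qed

section \<open>Cycles as a partition of the points\<close>

definition cycles :: "nat \<Rightarrow> (nat \<Rightarrow> nat) \<Rightarrow> nat set set" where
  "cycles n \<sigma> = orbit \<sigma> ` {1..n}"

lemma cycles_disjoint:
  assumes "\<sigma> permutes {1..n}" "C \<in> cycles n \<sigma>" "D \<in> cycles n \<sigma>" "x \<in> C" "x \<in> D"
  shows "C = D"
  using assms orbit_permutes_eq unfolding cycles_def by (metis imageE)

lemma cycle_eq_orbit: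
  assumes "\<sigma> permutes {1..n}" "C \<in> cycles n \<sigma>" "a \<in> C"
  shows "C = orbit \<sigma> a"
  using assms orbit_permutes_eq unfolding cycles_def by (metis imageE)

lemma Union_cycles:
  assumes "\<sigma> permutes {1..n}"
  shows "\<Union> (cycles n \<sigma>) = {1..n}"
  using permutes_orbit_subset [OF assms] self_in_orbit_permutes [OF assms]
  unfolding cycles_def by blast

lemma finite_cycles: "finite (cycles n \<sigma>)"
  by (simp add: cycles_def)

lemma finite_cycle:
  assumes "\<sigma> permutes {1..n}" "C \<in> cycles n \<sigma>"
  shows "finite C"
  by (rule finite_subset [of _ "{1..n}"]) (use Union_cycles [OF assms(1)] assms in auto)

text \<open>The second claim makes the merged cycle a new element, as \<open>prod.insert\<close>
  requires: it shares \<open>a\<close> with \<open>C\<close>, so as an old cycle it could only be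
  \<open>C\<close>.\<close>

lemma cycles_merge:
  assumes \<sigma>: "\<sigma> permutes {1..n}" and C: "C \<in> cycles n \<sigma>" and D: "D \<in> cycles n \<sigma>"
    and "C \<noteq> D" and a: "a \<in> C" and b: "b \<in> D"
  shows "cycles n (\<sigma> \<circ> transpose a b) = insert (C \<union> D) (cycles n \<sigma> - {C} - {D})"
    and "C \<union> D \<notin> cycles n \<sigma> - {C} - {D}"
proof -
  let ?\<tau> = "\<sigma> \<circ> transpose a b"
  have ab: "a \<in> {1..n}" "b \<in> {1..n}"
    using Union_cycles [OF \<sigma>] assms by auto
  have Ca: "C = orbit \<sigma> a" and Db: "D = orbit \<sigma> b"
    using cycle_eq_orbit [OF \<sigma>] assms by auto
  have bC: "b \<notin> C"
    using cycles_disjoint [OF \<sigma> C D] assms by auto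
  have 1: "orbit ?\<tau> x = C \<union> D" if "x \<in> C \<union> D" for x
    using orbit_comp_transpose_merge [OF \<sigma> ab] bC that by (simp add: Ca Db)
  have 2: "orbit ?\<tau> x = orbit \<sigma> x" if "x \<notin> C \<union> D" for x
    using that orbit_permutes_eq [OF \<sigma>] self_in_orbit_permutes [OF \<sigma>]
    by (intro orbit_comp_transpose_same [OF \<sigma>]) (metis Ca Db UnI1 UnI2)+
  show "cycles n ?\<tau> = insert (C \<union> D) (cycles n \<sigma> - {C} - {D})"
  proof (intro equalityI subsetI)
    fix E assume "E \<in> cycles n ?\<tau>"
    then obtain x where x: "x \<in> {1..n}" "E = orbit ?\<tau> x"
      unfolding cycles_def by blast
    show "E \<in> insert (C \<union> D) (cycles n \<sigma> - {C} - {D})"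
    proof (cases "x \<in> C \<union> D")
      case True
      then show ?thesis using 1 x by simp
    next
      case False
      then have "E = orbit \<sigma> x" "x \<in> orbit \<sigma> x" using 2 x self_in_orbit_permutes [OF \<sigma>] by auto
      then show ?thesis using False x by (auto simp: cycles_def)
    qed
  next
    fix E assume "E \<in> insert (C \<union> D) (cycles n \<sigma> - {C} - {D})"
    then consider "E = C \<union> D" | "E \<in> cycles n \<sigma>" "E \<noteq> C" "E \<noteq> D" by blast
    then show "E \<in> cycles n ?\<tau>"
    proof cases
      case 1
      then have "E = orbit ?\<tau> a" using \<open>\<And>x. x \<in> C \<union> D \<Longrightarrow> orbit ?\<tau> x = C \<union> D\<close> a by simp
      then show ?thesis using ab by (simp add: cycles_def)
    next
      case E: 2
      from E(1) obtain x where x: "x \<in> {1..n}" "E = orbit \<sigma> x"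
        unfolding cycles_def by blast
      then have "x \<notin> C \<union> D"
        using E cycle_eq_orbit [OF \<sigma>] C D by blast
      then have "E = orbit ?\<tau> x" using 2 x by simp
      then show ?thesis using x by (simp add: cycles_def)
    qed
  qed
  show "C \<union> D \<notin> cycles n \<sigma> - {C} - {D}"
    using cycles_disjoint [OF \<sigma> _ C, of "C \<union> D" a] a by auto
qed

text \<open>Counting from 1 puts \<open>a\<close> last, at
  \<open>i = card (orbit \<sigma> a)\<close>. A cut after the \<open>k\<close>-th point then yields
  two intervals of indices.\<close>

lemma bij_betw_funpow_orbit:
  assumes \<sigma>: "\<sigma> permutes {1..n::nat}"
  shows "bij_betw (\<lambda>i. (\<sigma> ^^ i) a) {1..card (orbit \<sigma> a)} (orbit \<sigma> a)"
    and "(\<sigma> ^^ card (orbit \<sigma> a)) a = a"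
proof -
  note a = self_in_orbit_permutes [OF \<sigma>, of a]
  let ?d = "funpow_dist1 \<sigma> a a"
  have inj: "inj_on (\<lambda>i. (\<sigma> ^^ i) a) {0..<?d}" and im: "orbit \<sigma> a = (\<lambda>i. (\<sigma> ^^ i) a) ` {0..<?d}"
    using a by (rule inj_on_funpow_dist1, rule orbit_conv_funpow_dist1)
  have d: "card (orbit \<sigma> a) = ?d"
    unfolding im using card_image [OF inj] by simp
  show "(\<sigma> ^^ card (orbit \<sigma> a)) a = a"
    unfolding d by (rule funpow_dist1_prop [OF a])
  have "bij_betw (\<lambda>i. (\<sigma> ^^ i) a) {0..<?d} (orbit \<sigma> a)"
    using inj im by (simp add: bij_betw_def)
  \<comment> \<open>As \<open>\<sigma>\<close> permutes its own orbit, composing with it shifts the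
    enumeration from \<open>{0..<?d}\<close> to \<open>{1..?d}\<close>.\<close>
  moreover have "bij_betw \<sigma> (orbit \<sigma> a) (orbit \<sigma> a)"
  proof (rule bij_betw_imageI)
    show "inj_on \<sigma> (orbit \<sigma> a)"
      using permutes_inj [OF \<sigma>] by (rule inj_on_subset) simp
    show "\<sigma> ` orbit \<sigma> a = orbit \<sigma> a"
      using orbit_inverse [OF a, of \<sigma> \<sigma>] permutation_orbit_step [of \<sigma> a] \<sigma> permutation_permutes by auto
  qed
  ultimately have "bij_betw (\<sigma> \<circ> (\<lambda>i. (\<sigma> ^^ i) a)) {0..<?d} (orbit \<sigma> a)"
    by (rule bij_betw_trans)
  then have "bij_betw (\<lambda>i. (\<sigma> ^^ Suc i) a) {0..<?d} (orbit \<sigma> a)"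
    by (simp add: o_def)
  then have "bij_betw ((\<lambda>i. (\<sigma> ^^ i) a) \<circ> Suc) {0..<?d} (orbit \<sigma> a)"
    by (simp add: o_def)
  moreover have "bij_betw Suc {0..<?d} {1..?d}"
    by (auto simp: bij_betw_def image_Suc_atLeastLessThan atLeastLessThanSuc_atLeastAtMost)
  ultimately show "bij_betw (\<lambda>i. (\<sigma> ^^ i) a) {1..card (orbit \<sigma> a)} (orbit \<sigma> a)"
    unfolding d using bij_betw_comp_iff by blast
qed

text \<open>The product still sends \<open>s i\<close> to \<open>s (i + 1)\<close>, except that
  \<open>s k\<close> now returns to \<open>s 1\<close> and \<open>s p = a\<close> goes to
  \<open>s (k + 1)\<close>. The cycle thus closes up into two arcs.\<close>

lemma orbit_comp_transpose_split:
  fixes a k n \<sigma>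
  defines "s \<equiv> \<lambda>i. (\<sigma> ^^ i) a" and "p \<equiv> card (orbit \<sigma> a)"
  assumes \<sigma>: "\<sigma> permutes {1..n::nat}" and k: "1 \<le> k" "k < p"
  shows "orbit (\<sigma> \<circ> transpose a (s k)) (s k) = s ` {1..k}"
    and "orbit (\<sigma> \<circ> transpose a (s k)) a = s ` {k+1..p}"
proof -
  let ?\<tau> = "\<sigma> \<circ> transpose a (s k)"
  have inj: "inj_on s {1..p}" and sp: "s p = a"
    using bij_betw_funpow_orbit [OF \<sigma>, of a] by (simp_all add: s_def p_def bij_betw_def)
  have \<tau>s: "?\<tau> (s i) = s (Suc i)" if "1 \<le> i" "i < p" "i \<noteq> k" for i
  proof -
    have "s i \<noteq> s k" "s i \<noteq> s p"
      using inj that k by (auto dest: inj_onD)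
    then show ?thesis
      unfolding sp by (simp add: s_def)
  qed
  have \<tau>k: "?\<tau> (s k) = s 1" and \<tau>a: "?\<tau> a = s (Suc k)"
    by (simp_all add: s_def)
  show "orbit ?\<tau> (s k) = s ` {1..k}"
  proof (intro equalityI subsetI)
    fix y assume "y \<in> orbit ?\<tau> (s k)"
    then show "y \<in> s ` {1..k}"
    proof induction
      case base
      show ?case unfolding \<tau>k using k by auto
    next
      case (step y)
      then obtain i where i: "y = s i" "1 \<le> i" "i \<le> k" by auto
      show ?case
      proof (cases "i = k")
        case True
        then show ?thesis unfolding i \<tau>k True using k by auto
      next
        case False
        then have "?\<tau> y = s (Suc i)" unfolding i using i k by (intro \<tau>s) auto
        then show ?thesis using i False by auto
      qed
    qed
  next
    fix y assume "y \<in> s ` {1..k}"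
    then obtain i where "y = s i" "1 \<le> i" "i \<le> k" by auto
    moreover have "i \<le> k \<longrightarrow> s i \<in> orbit ?\<tau> (s k)" if "1 \<le> i" for i
      using that
    proof (induction i rule: nat_induct_at_least)
      case base
      show ?case using orbit.base [of ?\<tau> "s k"] unfolding \<tau>k by blast
    next
      case (Suc i)
      show ?case
      proof
        assume "Suc i \<le> k"
        moreover from this have "?\<tau> (s i) \<in> orbit ?\<tau> (s k)"
          by (intro orbit.step Suc.IH [THEN mp]) simp
        ultimately show "s (Suc i) \<in> orbit ?\<tau> (s k)"
          using \<tau>s [of i] Suc.hyps k by simp
      qed
    qed
    ultimately show "y \<in> orbit ?\<tau> (s k)" by blast
  qed
  show "orbit ?\<tau> a = s ` {k+1..p}"
  proof (intro equalityI subsetI)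
    fix y assume "y \<in> orbit ?\<tau> a"
    then show "y \<in> s ` {k+1..p}"
    proof induction
      case base
      show ?case unfolding \<tau>a using k by auto
    next
      case (step y)
      then obtain i where i: "y = s i" "Suc k \<le> i" "i \<le> p" by auto
      show ?case
      proof (cases "i = p")
        case True
        then show ?thesis unfolding i True sp \<tau>a using k by auto
      next
        case False
        then have "?\<tau> y = s (Suc i)" unfolding i using i k by (intro \<tau>s) auto
        then show ?thesis using i False by auto
      qed
    qed
  next
    fix y assume "y \<in> s ` {k+1..p}"
    then obtain i where "y = s i" "Suc k \<le> i" "i \<le> p" by auto
    moreover have "i \<le> p \<longrightarrow> s i \<in> orbit ?\<tau> a" if "Suc k \<le> i" for i
      using that
    proof (induction i rule: nat_induct_at_least)
      case base
      show ?case using orbit.base [of ?\<tau> a] unfolding \<tau>a by blast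
    next
      case (Suc i)
      show ?case
      proof
        assume "Suc i \<le> p"
        moreover from this have "?\<tau> (s i) \<in> orbit ?\<tau> a"
          by (intro orbit.step Suc.IH [THEN mp]) simp
        ultimately show "s (Suc i) \<in> orbit ?\<tau> a"
          using \<tau>s [of i] Suc.hyps k by simp
      qed
    qed
    ultimately show "y \<in> orbit ?\<tau> a" by blast
  qed
qed

text \<open>The non-membership claims let \<open>prod.insert\<close> expand the new product over
  cycles, and the cardinalities identify its two new factors.\<close>

lemma cycles_split:
  fixes a k n \<sigma>
  defines "s \<equiv> \<lambda>i. (\<sigma> ^^ i) a"
  assumes \<sigma>: "\<sigma> permutes {1..n}" and C: "C \<in> cycles n \<sigma>" and a: "a \<in> C"
    and k: "1 \<le> k" "k < card C"
  shows "cycles n (\<sigma> \<circ> transpose a (s k)) = insert (s ` {1..k}) (insert (s ` {k+1..card C}) (cycles n \<sigma> - {C}))"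
    and "s ` {1..k} \<notin> insert (s ` {k+1..card C}) (cycles n \<sigma> - {C})"
    and "s ` {k+1..card C} \<notin> cycles n \<sigma> - {C}"
    and "card (s ` {1..k}) = k" "card (s ` {k+1..card C}) = card C - k"
proof -
  let ?\<tau> = "\<sigma> \<circ> transpose a (s k)" and ?A = "s ` {1..k}" and ?B = "s ` {k+1..card C}"
  have Ca: "C = orbit \<sigma> a"
    using cycle_eq_orbit [OF \<sigma> C a] .
  have inj: "inj_on s {1..card C}" and sC: "s ` {1..card C} = C"
    using bij_betw_funpow_orbit(1) [OF \<sigma>, of a] by (simp_all add: s_def Ca bij_betw_def)
  show "card ?A = k" "card ?B = card C - k"
    using k by (simp_all add: card_image inj_on_subset [OF inj])
  have AB: "?A \<union> ?B = C"
  proof -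
    have "{1..k} \<union> {k+1..card C} = {1..card C}"
      using k by auto
    then show ?thesis
      using sC by (simp flip: image_Un)
  qed
  have disj: "?A \<inter> ?B = {}"
    using inj_on_image_Int [OF inj, of "{1..k}" "{k+1..card C}"] k by auto
  \<comment> \<open>\<open>a\<close> lies on the second arc as its last point,
    \<open>s (card C)\<close>.\<close>
  have ne: "s k \<in> ?A" "a \<in> ?B" "s k \<in> C"
    using k AB bij_betw_funpow_orbit(2) [OF \<sigma>, of a] by (auto simp: s_def Ca intro: image_eqI [where x = "card C"])
  then show "?A \<notin> insert ?B (cycles n \<sigma> - {C})" "?B \<notin> cycles n \<sigma> - {C}"
    using disj AB cycles_disjoint [OF \<sigma> C] a by blast+
  have ab: "a \<in> {1..n}" "s k \<in> {1..n}"
    using Union_cycles [OF \<sigma>] C a ne by auto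
  note \<tau> = permutes_comp_transpose [OF \<sigma> ab]
  have oA: "orbit ?\<tau> x = ?A" if "x \<in> ?A" for x
    using orbit_comp_transpose_split(1) [OF \<sigma>, of k a] orbit_permutes_eq [OF \<tau>, of x "s k"] k that
    by (simp add: s_def Ca)
  have oB: "orbit ?\<tau> x = ?B" if "x \<in> ?B" for x
    using orbit_comp_transpose_split(2) [OF \<sigma>, of k a] orbit_permutes_eq [OF \<tau>, of x a] k that
    by (simp add: s_def Ca)
  have o: "orbit ?\<tau> x = orbit \<sigma> x" if "x \<notin> C" for x
    using that ne a cycle_eq_orbit [OF \<sigma> C] orbit_permutes_eq [OF \<sigma>] self_in_orbit_permutes [OF \<sigma>]
    by (intro orbit_comp_transpose_same [OF \<sigma>]) metis+
  show "cycles n ?\<tau> = insert ?A (insert ?B (cycles n \<sigma> - {C}))"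
  proof (intro equalityI subsetI)
    fix E assume "E \<in> cycles n ?\<tau>"
    then obtain x where x: "x \<in> {1..n}" "E = orbit ?\<tau> x"
      unfolding cycles_def by blast
    show "E \<in> insert ?A (insert ?B (cycles n \<sigma> - {C}))"
    proof (cases "x \<in> C")
      case True
      then have "x \<in> ?A \<or> x \<in> ?B" using AB by blast
      then have "E = ?A \<or> E = ?B" using oA oB x(2) by metis
      then show ?thesis by blast
    next
      case False
      then have "E = orbit \<sigma> x" "x \<in> orbit \<sigma> x" using o x self_in_orbit_permutes [OF \<sigma>] by auto
      then show ?thesis using False x by (auto simp: cycles_def)
    qed
  next
    fix E assume "E \<in> insert ?A (insert ?B (cycles n \<sigma> - {C}))"
    then consider "E = orbit ?\<tau> (s k)" | "E = orbit ?\<tau> a" | "E \<in> cycles n \<sigma>" "E \<noteq> C"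
      unfolding oA [OF ne(1)] oB [OF ne(2)] by blast
    then show "E \<in> cycles n ?\<tau>"
    proof cases
      case 3
      from 3(1) obtain x where x: "x \<in> {1..n}" "E = orbit \<sigma> x"
        unfolding cycles_def by blast
      then have "x \<notin> C"
        using 3 cycle_eq_orbit [OF \<sigma> C] by blast
      then have "E = orbit ?\<tau> x" using o x by simp
      then show ?thesis using x by (simp add: cycles_def)
    qed (use ab in \<open>simp_all add: cycles_def\<close>)
  qed
qed

section \<open>Schur's lemma for the class sum of transpositions\<close>

lemma rep_carrier:
  assumes "representation n d \<rho>" "\<sigma> permutes {1..n}"
  shows "\<rho> \<sigma> \<in> carrier_mat d d"
  using assms
  by (auto simp: representation_def hom_def sym_group_carrier units_of_def Units_def ring_mat_simps)

lemma rep_comp: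
  assumes "representation n d \<rho>" "\<sigma> permutes {1..n}" "\<tau> permutes {1..n}"
  shows "\<rho> (\<sigma> \<circ> \<tau>) = \<rho> \<sigma> * \<rho> \<tau>"
  using assms
  by (auto simp: representation_def hom_def sym_group_carrier sym_group_mult units_of_def ring_mat_simps)

text \<open>This is the form in which the condition in \<open>irreducible_rep\<close> can be applied
  to an eigenspace.\<close>

lemma eigenspace_subspace:
  fixes M :: "complex mat"
  assumes M: "M \<in> carrier_mat d d"
  shows "VectorSpace.subspace class_ring {v \<in> carrier_vec d. M *\<^sub>v v = k \<cdot>\<^sub>v v} (module_vec TYPE(complex) d)"
proof (intro VectorSpace.subspace.intro submodule.intro)
  show "vectorspace class_ring (module_vec TYPE(complex) d)"
    by (rule vec_vs)
  show "Module.module class_ring (module_vec TYPE(complex) d)"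
    by (rule vec_module)
qed (use M in \<open>auto simp: module_vec_simps class_ring_simps mult_add_distrib_mat_vec mult_mat_vec smult_add_distrib_vec smult_smult_assoc mult.commute\<close>)

lemma index_times_mat:
  assumes "A \<in> carrier_mat d d" "B \<in> carrier_mat d d" "i < d" "j < d"
  shows "(A * B) $$ (i, j) = (\<Sum>l<d. A $$ (i, l) * B $$ (l, j))"
  using assms by (simp add: scalar_prod_def atLeast0LessThan)

text \<open>Since \<open>d > 0\<close>, the complex matrix \<open>M\<close> has an eigenvalue. Its
  eigenspace is invariant because \<open>M\<close> commutes with the representation, and it is
  nonzero, so irreducibility makes it the whole space.\<close>

lemma schur_scalar:
  assumes irr: "irreducible_rep n d \<rho>" and M: "M \<in> carrier_mat d d"
    and comm: "\<And>\<sigma>. \<sigma> permutes {1..n} \<Longrightarrow> M * \<rho> \<sigma> = \<rho> \<sigma> * M"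
  shows "\<exists>k. M = k \<cdot>\<^sub>m 1\<^sub>m d"
proof -
  have rep: "representation n d \<rho>" and d: "d > 0"
    using irr by (auto simp: irreducible_rep_def)
  obtain k where "eigenvalue M k"
    using spectrum_non_empty [OF M d] by (auto simp: spectrum_def)
  then obtain v where v: "v \<in> carrier_vec d" "v \<noteq> 0\<^sub>v d" "M *\<^sub>v v = k \<cdot>\<^sub>v v"
    using M by (auto simp: eigenvalue_def eigenvector_def)
  define W where "W = {v \<in> carrier_vec d. M *\<^sub>v v = k \<cdot>\<^sub>v v}"
  have "\<rho> \<sigma> *\<^sub>v w \<in> W" if \<sigma>: "\<sigma> permutes {1..n}" and w: "w \<in> W" for \<sigma> w
  proof -
    note \<rho> = rep_carrier [OF rep \<sigma>]
    have "M *\<^sub>v (\<rho> \<sigma> *\<^sub>v w) = (M * \<rho> \<sigma>) *\<^sub>v w"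
      using M \<rho> w by (simp add: W_def)
    also have "\<dots> = \<rho> \<sigma> *\<^sub>v (M *\<^sub>v w)"
      unfolding comm [OF \<sigma>] using M \<rho> w by (simp add: W_def)
    also have "\<dots> = k \<cdot>\<^sub>v (\<rho> \<sigma> *\<^sub>v w)"
      using \<rho> w by (simp add: W_def mult_mat_vec)
    finally show ?thesis
      using \<rho> w by (simp add: W_def)
  qed
  then have "\<forall>\<sigma>\<in>carrier (sym_group n). \<forall>w\<in>W. \<rho> \<sigma> *\<^sub>v w \<in> W"
    by (simp add: sym_group_carrier)
  moreover have "VectorSpace.subspace class_ring W (module_vec TYPE(complex) d)"
    unfolding W_def by (rule eigenspace_subspace [OF M])
  ultimately have "W = {0\<^sub>v d} \<or> W = carrier_vec d"
    using irr unfolding irreducible_rep_def by blast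
  moreover have "W \<noteq> {0\<^sub>v d}"
    using v by (auto simp: W_def)
  ultimately have W: "M *\<^sub>v w = k \<cdot>\<^sub>v w" if "w \<in> carrier_vec d" for w
    using that by (auto simp: W_def)
  have "M = k \<cdot>\<^sub>m 1\<^sub>m d"
  proof (rule eq_matI)
    fix i j assume ij: "i < dim_row (k \<cdot>\<^sub>m 1\<^sub>m d)" "j < dim_col (k \<cdot>\<^sub>m 1\<^sub>m d)"
    then have "M $$ (i, j) = (M *\<^sub>v unit_vec d j) $ i"
      using M by (simp add: scalar_prod_right_unit)
    also have "\<dots> = (k \<cdot>\<^sub>v unit_vec d j) $ i"
      by (simp add: W)
    finally show "M $$ (i, j) = (k \<cdot>\<^sub>m 1\<^sub>m d) $$ (i, j)"
      using ij by (auto simp: unit_vec_def)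
  qed (use M in auto)
  then show ?thesis ..
qed

text \<open>Ordered pairs: every transposition is counted twice.\<close>

definition off_diag :: "nat \<Rightarrow> (nat \<times> nat) set" where
  "off_diag n = {1..n} \<times> {1..n} - Id"

lemma finite_off_diag: "finite (off_diag n)"
  by (simp add: off_diag_def)

text \<open>Conjugation by \<open>\<sigma>\<close> relabels the two points of a transposition; this
  is its effect on ordered pairs.\<close>

lemma off_diag_permutes:
  assumes "\<sigma> permutes {1..n}"
  shows "bij_betw (map_prod \<sigma> \<sigma>) (off_diag n) (off_diag n)"
proof (rule bij_betw_imageI)
  have inj: "inj \<sigma>"
    using assms by (rule permutes_inj)
  then show "inj_on (map_prod \<sigma> \<sigma>) (off_diag n)"
    by (auto simp: inj_on_def)
  show "map_prod \<sigma> \<sigma> ` off_diag n = off_diag n"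
  proof (rule card_subset_eq [OF finite_off_diag])
    show "map_prod \<sigma> \<sigma> ` off_diag n \<subseteq> off_diag n"
      using permutes_in_image [OF assms] inj by (auto simp: off_diag_def dest: injD)
    show "card (map_prod \<sigma> \<sigma> ` off_diag n) = card (off_diag n)"
      by (rule card_image) fact
  qed
qed

lemma transpose_permutes:
  "(a, b) \<in> off_diag n \<Longrightarrow> transpose a b permutes {1..n}"
  by (auto simp: off_diag_def intro: permutes_swap_id)

text \<open>The matrix \<open>M\<close>, the sum of \<open>\<rho>\<close> over the transpositions,
  commutes with the representation and is therefore a scalar \<open>k\<close>. Taking the trace of
  \<open>\<rho> \<sigma> * M\<close> gives the claim with one \<open>k\<close> for all
  \<open>\<sigma>\<close>.\<close>

lemma character_transposition_sum:
  assumes "irreducible_character n \<chi>"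
  obtains k where "\<And>\<sigma>. \<sigma> permutes {1..n} \<Longrightarrow>
    (\<Sum>(a, b)\<in>off_diag n. \<chi> (\<sigma> \<circ> transpose a b)) = k * \<chi> \<sigma>"
proof -
  obtain d \<rho> where irr: "irreducible_rep n d \<rho>"
    and \<chi>: "\<And>\<sigma>. \<sigma> permutes {1..n} \<Longrightarrow> \<chi> \<sigma> = mat_tr (\<rho> \<sigma>)"
    using assms by (auto simp: irreducible_character_def sym_group_carrier)
  then have rep: "representation n d \<rho>"
    by (simp add: irreducible_rep_def)
  define t where "t = (\<lambda>(a, b). transpose a b :: nat \<Rightarrow> nat)"
  have t: "t x permutes {1..n}" if "x \<in> off_diag n" for x
    using that transpose_permutes by (cases x) (auto simp: t_def)
  define M where "M = mat d d (\<lambda>(i, j). \<Sum>x\<in>off_diag n. \<rho> (t x) $$ (i, j))"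
  have M: "M \<in> carrier_mat d d"
    by (simp add: M_def)
  have left: "(\<rho> \<sigma> * M) $$ (i, j) = (\<Sum>x\<in>off_diag n. \<rho> (\<sigma> \<circ> t x) $$ (i, j))"
    if \<sigma>: "\<sigma> permutes {1..n}" and ij: "i < d" "j < d" for \<sigma> i j
  proof -
    have "(\<rho> \<sigma> * M) $$ (i, j) = (\<Sum>l<d. \<rho> \<sigma> $$ (i, l) * (\<Sum>x\<in>off_diag n. \<rho> (t x) $$ (l, j)))"
      using rep_carrier [OF rep \<sigma>] ij by (simp add: M_def scalar_prod_def atLeast0LessThan)
    also have "\<dots> = (\<Sum>x\<in>off_diag n. \<Sum>l<d. \<rho> \<sigma> $$ (i, l) * \<rho> (t x) $$ (l, j))"
      unfolding sum_distrib_left by (rule sum.swap)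
    also have "\<dots> = (\<Sum>x\<in>off_diag n. (\<rho> \<sigma> * \<rho> (t x)) $$ (i, j))"
      using ij rep_carrier [OF rep \<sigma>] by (intro sum.cong) (simp_all add: index_times_mat [where d = d] rep_carrier [OF rep t])
    finally show ?thesis
      using rep_comp [OF rep \<sigma> t] by simp
  qed
  have right: "(M * \<rho> \<sigma>) $$ (i, j) = (\<Sum>x\<in>off_diag n. \<rho> (t x \<circ> \<sigma>) $$ (i, j))"
    if \<sigma>: "\<sigma> permutes {1..n}" and ij: "i < d" "j < d" for \<sigma> i j
  proof -
    have "(M * \<rho> \<sigma>) $$ (i, j) = (\<Sum>l<d. (\<Sum>x\<in>off_diag n. \<rho> (t x) $$ (i, l)) * \<rho> \<sigma> $$ (l, j))"
      using rep_carrier [OF rep \<sigma>] ij by (simp add: M_def scalar_prod_def atLeast0LessThan)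
    also have "\<dots> = (\<Sum>x\<in>off_diag n. \<Sum>l<d. \<rho> (t x) $$ (i, l) * \<rho> \<sigma> $$ (l, j))"
      unfolding sum_distrib_right by (rule sum.swap)
    also have "\<dots> = (\<Sum>x\<in>off_diag n. (\<rho> (t x) * \<rho> \<sigma>) $$ (i, j))"
      using ij rep_carrier [OF rep \<sigma>] by (intro sum.cong) (simp_all add: index_times_mat [where d = d] rep_carrier [OF rep t])
    finally show ?thesis
      using rep_comp [OF rep t \<sigma>] by simp
  qed
  have "M * \<rho> \<sigma> = \<rho> \<sigma> * M" if \<sigma>: "\<sigma> permutes {1..n}" for \<sigma>
  proof (rule eq_matI)
    \<comment> \<open>Passing a transposition across \<open>\<sigma>\<close> only relabels it, so
      reindexing turns the sum for \<open>M * \<rho> \<sigma>\<close> into the one for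
      \<open>\<rho> \<sigma> * M\<close>.\<close>
    have conj: "t (map_prod \<sigma> \<sigma> x) \<circ> \<sigma> = \<sigma> \<circ> t x" for x
      by (cases x) (auto simp: t_def fun_eq_iff transpose_def inj_eq [OF permutes_inj [OF \<sigma>]])
    fix i j assume "i < dim_row (\<rho> \<sigma> * M)" "j < dim_col (\<rho> \<sigma> * M)"
    then have ij: "i < d" "j < d"
      using rep_carrier [OF rep \<sigma>] M by auto
    have "(\<Sum>x\<in>off_diag n. \<rho> (t x \<circ> \<sigma>) $$ (i, j)) = (\<Sum>x\<in>off_diag n. \<rho> (t (map_prod \<sigma> \<sigma> x) \<circ> \<sigma>) $$ (i, j))"
      by (rule sum.reindex_bij_betw [OF off_diag_permutes [OF \<sigma>], symmetric])
    then show "(M * \<rho> \<sigma>) $$ (i, j) = (\<rho> \<sigma> * M) $$ (i, j)"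
      unfolding left [OF \<sigma> ij] right [OF \<sigma> ij] conj .
  qed (use rep_carrier [OF rep \<sigma>] M in auto)
  then obtain k where k: "M = k \<cdot>\<^sub>m 1\<^sub>m d"
    using schur_scalar [OF irr M] by blast
  have "(\<Sum>(a, b)\<in>off_diag n. \<chi> (\<sigma> \<circ> transpose a b)) = k * \<chi> \<sigma>" if \<sigma>: "\<sigma> permutes {1..n}" for \<sigma>
  proof -
    note \<rho> = rep_carrier [OF rep]
    have "(\<Sum>(a, b)\<in>off_diag n. \<chi> (\<sigma> \<circ> transpose a b)) = (\<Sum>x\<in>off_diag n. mat_tr (\<rho> (\<sigma> \<circ> t x)))"
      using permutes_compose [OF t \<sigma>] by (intro sum.cong) (auto simp: t_def \<chi>)
    also have "\<dots> = (\<Sum>x\<in>off_diag n. \<Sum>i<d. \<rho> (\<sigma> \<circ> t x) $$ (i, i))"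
      using \<rho> [OF permutes_compose [OF t \<sigma>]] by (intro sum.cong) (auto simp: mat_tr_def)
    also have "\<dots> = (\<Sum>i<d. (\<rho> \<sigma> * M) $$ (i, i))"
      by (subst sum.swap) (simp add: left [OF \<sigma>])
    also have "\<rho> \<sigma> * M = k \<cdot>\<^sub>m \<rho> \<sigma>"
      using \<rho> [OF \<sigma>] unfolding k by (simp add: mult_smult_distrib [OF _ one_carrier_mat])
    also have "(\<Sum>i<d. (k \<cdot>\<^sub>m \<rho> \<sigma>) $$ (i, i)) = k * \<chi> \<sigma>"
      using \<rho> [OF \<sigma>] by (simp add: \<chi> [OF \<sigma>] mat_tr_def sum_distrib_left)
    finally show ?thesis .
  qed
  with that show ?thesis by blast
qed

section \<open>The eigenvalue equation\<close>

lemma Gam_1: "Gam F 1 = 0"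
  by (simp add: Gam_def)

lemma Gam_prod:
  assumes "finite I"
  shows "Gam F (prod f I) = (\<Sum>i\<in>I. Gam F (f i) * prod f (I - {i}))"
  using assms
proof induction
  case empty
  show ?case by (simp add: Gam_1)
next
  case (insert i I)
  have "Gam F (prod f (insert i I)) = f i * Gam F (prod f I) + Gam F (f i) * prod f I"
    using insert.hyps Gam_mult [of "f i" "prod f I" F]
    by (simp add: Gam_commute [of F] mult.commute)
  also have "f i * Gam F (prod f I) = (\<Sum>j\<in>I. Gam F (f j) * prod f (insert i I - {j}))"
    unfolding insert.IH sum_distrib_left
  proof (rule sum.cong)
    fix j assume "j \<in> I"
    then have "insert i I - {j} = insert i (I - {j})" "i \<notin> I - {j}"
      using insert.hyps by auto
    then show "f i * (Gam F (f j) * prod f (I - {j})) = Gam F (f j) * prod f (insert i I - {j})"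
      using insert.hyps by (simp add: mult_ac)
  qed simp
  finally show ?case
    using insert.hyps by (simp add: add.commute)
qed

text \<open>Iterating \<open>L_half_mult\<close> gives one \<open>Gam\<close> term per unordered
  pair of factors. Doubling matches the sum over ordered pairs.\<close>

lemma L_half_prod:
  assumes "finite I"
  shows "2 * L_half (prod f I) = (\<Sum>i\<in>I. 2 * L_half (f i) * prod f (I - {i}))
    + (\<Sum>i\<in>I. \<Sum>j\<in>I - {i}. Gam (f i) (f j) * prod f (I - {i} - {j}))"
  using assms
proof induction
  case empty
  show ?case by (simp add: L_half_def)
next
  case (insert i I)
  have ins: "insert i I - {j} = insert i (I - {j})" if "j \<in> I" for j
    using insert.hyps that by auto
  have ins2: "insert i (I - {j}) - {l} = insert i (I - {j} - {l})" if "l \<in> I" for j l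
    using insert.hyps that by auto
  have 1: "(\<Sum>j\<in>insert i I. 2 * L_half (f j) * prod f (insert i I - {j}))
    = 2 * L_half (f i) * prod f I + f i * (\<Sum>j\<in>I. 2 * L_half (f j) * prod f (I - {j}))"
    using insert.hyps by (simp add: ins sum_distrib_left mult_ac)
  have "(\<Sum>j\<in>I. \<Sum>l\<in>insert i I - {j}. Gam (f j) (f l) * prod f (insert i I - {j} - {l}))
    = (\<Sum>j\<in>I. Gam (f j) (f i) * prod f (I - {j})
        + f i * (\<Sum>l\<in>I - {j}. Gam (f j) (f l) * prod f (I - {j} - {l})))"
    using insert.hyps by (intro sum.cong) (simp_all add: ins ins2 sum_distrib_left mult_ac)
  then have 2: "(\<Sum>j\<in>insert i I. \<Sum>l\<in>insert i I - {j}. Gam (f j) (f l) * prod f (insert i I - {j} - {l}))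
    = 2 * Gam (f i) (prod f I)
      + f i * (\<Sum>j\<in>I. \<Sum>l\<in>I - {j}. Gam (f j) (f l) * prod f (I - {j} - {l}))"
    using insert.hyps
    by (simp add: Gam_prod sum.distrib sum_distrib_left Gam_commute [of _ "f i"])
  have "2 * L_half (prod f (insert i I)) = 2 * L_half (f i) * prod f I
    + f i * (2 * L_half (prod f I)) + 2 * Gam (f i) (prod f I)"
    using insert.hyps by (simp add: L_half_mult algebra_simps)
  then show ?case
    unfolding insert.IH 1 2 by (simp only: distrib_left add_ac)
qed

section \<open>Transpositions acting on products over cycles\<close>

lemma T_perm_cycles: "T_perm n \<sigma> = (\<Prod>C\<in>cycles n \<sigma>. T (int (card C)))"
  by (simp add: T_perm_def cycles_def)

lemma T_perm_merge:
  assumes \<sigma>: "\<sigma> permutes {1..n}" and C: "C \<in> cycles n \<sigma>" and D: "D \<in> cycles n \<sigma> - {C}"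
    and "a \<in> C" "b \<in> D"
  shows "T_perm n (\<sigma> \<circ> transpose a b)
    = T (int (card C) + int (card D)) * (\<Prod>E\<in>cycles n \<sigma> - {C} - {D}. T (int (card E)))"
proof -
  have "C \<inter> D = {}"
    using cycles_disjoint [OF \<sigma> C] D by blast
  then have "card (C \<union> D) = card C + card D"
    using finite_cycle [OF \<sigma>] C D by (intro card_Un_disjoint) auto
  moreover have "D \<in> cycles n \<sigma>" "C \<noteq> D"
    using D by auto
  note merge = cycles_merge [OF \<sigma> C this \<open>a \<in> C\<close> \<open>b \<in> D\<close>]
  ultimately show ?thesis
    unfolding T_perm_cycles merge(1) using merge(2)
    by (simp only: prod.insert finite_Diff finite_cycles not_False_eq_True of_nat_add)
qed

text \<open>The points of \<open>C\<close> other than \<open>a\<close> are reached from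
  \<open>a\<close> after \<open>k\<close> steps with \<open>1 \<le> k < card C\<close>, and
  transposing \<open>a\<close> with such a point leaves arcs of lengths \<open>k\<close> and
  \<open>card C - k\<close>.\<close>

lemma sum_T_perm_split:
  assumes \<sigma>: "\<sigma> permutes {1..n}" and C: "C \<in> cycles n \<sigma>" and a: "a \<in> C"
  shows "(\<Sum>b\<in>C - {a}. T_perm n (\<sigma> \<circ> transpose a b))
    = split_sum (card C) * (\<Prod>E\<in>cycles n \<sigma> - {C}. T (int (card E)))"
proof -
  have Ca: "C = orbit \<sigma> a"
    using cycle_eq_orbit [OF \<sigma> C a] .
  have C0: "card C > 0"
    using a finite_cycle [OF \<sigma> C] by (auto simp: card_gt_0_iff)
  \<comment> \<open>Dropping the last index \<open>card C\<close> removes \<open>a\<close>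
    itself.\<close>
  have "bij_betw (\<lambda>i. (\<sigma> ^^ i) a) ({1..card C} - {card C}) (C - {(\<sigma> ^^ card C) a})"
    using bij_betw_funpow_orbit [OF \<sigma>, of a] C0 a
    by (intro bij_betw_DiffI) (auto simp flip: Ca)
  moreover have "{1..card C} - {card C} = {1..<card C}"
    by auto
  moreover have "(\<sigma> ^^ card C) a = a"
    using bij_betw_funpow_orbit [OF \<sigma>, of a] by (simp flip: Ca)
  ultimately have "bij_betw (\<lambda>i. (\<sigma> ^^ i) a) {1..<card C} (C - {a})"
    by simp
  then have "(\<Sum>b\<in>C - {a}. T_perm n (\<sigma> \<circ> transpose a b))
    = (\<Sum>k = 1..<card C. T_perm n (\<sigma> \<circ> transpose a ((\<sigma> ^^ k) a)))"
    by (rule sum.reindex_bij_betw [symmetric])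
  also have "\<dots> = (\<Sum>k = 1..<card C. T (int k) * T (int (card C - k)) * (\<Prod>E\<in>cycles n \<sigma> - {C}. T (int (card E))))"
  proof (rule sum.cong)
    fix k assume "k \<in> {1..<card C}"
    then have k: "1 \<le> k" "k < card C" by auto
    show "T_perm n (\<sigma> \<circ> transpose a ((\<sigma> ^^ k) a))
      = T (int k) * T (int (card C - k)) * (\<Prod>E\<in>cycles n \<sigma> - {C}. T (int (card E)))"
      unfolding T_perm_cycles cycles_split(1) [OF \<sigma> C a k]
      using cycles_split(2-5) [OF \<sigma> C a k]
      by (simp only: prod.insert finite_insert finite_Diff finite_cycles mult.assoc not_False_eq_True)
  qed simp
  also have "\<dots> = split_sum (card C) * (\<Prod>E\<in>cycles n \<sigma> - {C}. T (int (card E)))"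
    by (simp add: split_sum_def sum_distrib_right)
  finally show ?thesis .
qed

lemma sum_cycles:
  assumes "\<sigma> permutes {1..n}"
  shows "(\<Sum>x\<in>{1..n}. g x) = (\<Sum>C\<in>cycles n \<sigma>. \<Sum>x\<in>C. g x)"
  unfolding Union_cycles [OF assms, symmetric]
  using cycles_disjoint [OF assms] finite_cycle [OF assms]
  by (subst sum.Union_disjoint) auto

lemma sum_cycle_card:
  assumes "\<sigma> permutes {1..n}"
  shows "(\<Sum>C\<in>cycles n \<sigma>. of_nat (card C)) = (of_nat n :: bipoly)"
  using sum_cycles [OF assms, of "\<lambda>_. 1 :: bipoly"] by simp

text \<open>For \<open>a\<close> in a cycle \<open>C\<close>, a point \<open>b\<close> of
  \<open>C\<close> splits it and a point of another cycle \<open>D\<close> merges the two. The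
  weights \<open>c C\<close> and \<open>c C * c D\<close> count the choices of \<open>a\<close> and
  of \<open>(a, b)\<close>.\<close>

lemma sum_off_diag_T_perm:
  assumes \<sigma>: "\<sigma> permutes {1..n}"
  defines "Q \<equiv> cycles n \<sigma>" and "t \<equiv> \<lambda>C. T (int (card C))" and "c \<equiv> \<lambda>C. of_nat (card C) :: bipoly"
  shows "(\<Sum>(a, b)\<in>off_diag n. T_perm n (\<sigma> \<circ> transpose a b))
    = (\<Sum>C\<in>Q. c C * split_sum (card C) * prod t (Q - {C}))
      + (\<Sum>C\<in>Q. \<Sum>D\<in>Q - {C}. c C * c D * T (int (card C) + int (card D)) * prod t (Q - {C} - {D}))"
proof -
  let ?g = "\<lambda>a b. T_perm n (\<sigma> \<circ> transpose a b)"
  have fin: "finite Q" "\<And>C. C \<in> Q \<Longrightarrow> finite C"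
    using finite_cycles finite_cycle [OF \<sigma>] by (auto simp: Q_def)
  have inner: "(\<Sum>b\<in>{1..n} - {a}. ?g a b) = split_sum (card C) * prod t (Q - {C})
      + (\<Sum>D\<in>Q - {C}. c D * (T (int (card C) + int (card D)) * prod t (Q - {C} - {D})))"
    if C: "C \<in> Q" and a: "a \<in> C" for C a
  proof -
    have aD: "a \<notin> D" if "D \<in> Q - {C}" for D
      using cycles_disjoint [OF \<sigma>, of C D a] C a that by (auto simp: Q_def)
    have "a \<in> {1..n}"
      using Union_cycles [OF \<sigma>] C a by (auto simp: Q_def)
    \<comment> \<open>The diagonal term is restored so that the sum over all \<open>b\<close> can be
      grouped by cycles; it is removed again inside \<open>C\<close>.\<close>
    then have "(\<Sum>b\<in>{1..n} - {a}. ?g a b) = (\<Sum>b\<in>{1..n}. ?g a b) - ?g a a"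
      by (simp add: sum_diff1)
    also have "\<dots> = (\<Sum>b\<in>C. ?g a b) - ?g a a + (\<Sum>D\<in>Q - {C}. \<Sum>b\<in>D. ?g a b)"
      unfolding sum_cycles [OF \<sigma>] Q_def [symmetric] by (subst sum.remove [OF fin(1) C]) simp
    also have "(\<Sum>b\<in>C. ?g a b) - ?g a a = (\<Sum>b\<in>C - {a}. ?g a b)"
      using fin(2) [OF C] a by (simp add: sum_diff1)
    also have "\<dots> = split_sum (card C) * prod t (Q - {C})"
      using sum_T_perm_split [OF \<sigma>, of C a] C a by (simp add: Q_def t_def)
    also have "(\<Sum>D\<in>Q - {C}. \<Sum>b\<in>D. ?g a b)
      = (\<Sum>D\<in>Q - {C}. \<Sum>b\<in>D. T (int (card C) + int (card D)) * prod t (Q - {C} - {D}))"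
      using C a by (intro sum.cong) (simp_all add: T_perm_merge [OF \<sigma>] Q_def t_def)
    also have "\<dots> = (\<Sum>D\<in>Q - {C}. c D * (T (int (card C) + int (card D)) * prod t (Q - {C} - {D})))"
      by (simp add: c_def)
    finally show ?thesis .
  qed
  have "(\<Sum>(a, b)\<in>off_diag n. ?g a b) = (\<Sum>a\<in>{1..n}. \<Sum>b\<in>{1..n} - {a}. ?g a b)"
    by (subst sum.Sigma) (auto simp: off_diag_def intro!: sum.cong)
  also have "\<dots> = (\<Sum>C\<in>Q. \<Sum>a\<in>C. split_sum (card C) * prod t (Q - {C})
      + (\<Sum>D\<in>Q - {C}. c D * (T (int (card C) + int (card D)) * prod t (Q - {C} - {D}))))"
    unfolding sum_cycles [OF \<sigma>] Q_def [symmetric] by (intro sum.cong refl inner)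
  also have "\<dots> = (\<Sum>C\<in>Q. c C * split_sum (card C) * prod t (Q - {C}))
      + (\<Sum>C\<in>Q. \<Sum>D\<in>Q - {C}. c C * c D * T (int (card C) + int (card D)) * prod t (Q - {C} - {D}))"
    by (simp add: c_def distrib_left sum.distrib sum_distrib_left mult.assoc)
  finally show ?thesis .
qed

text \<open>In \<open>L_half_prod\<close>, single cycles are evaluated by \<open>L_half_T\<close>
  and pairs by \<open>Gam_T\<close>. The splitting and merging terms form the transposition sum,
  while the scalar terms combine because the cycle lengths add up to \<open>n\<close>.\<close>

lemma L_half_T_perm:
  assumes \<sigma>: "\<sigma> permutes {1..n}"
  shows "2 * L_half (T_perm n \<sigma>) = (of_nat n ^ 2 - 9 * of_nat n) * T_perm n \<sigma>
    - 3 * (\<Sum>(a, b)\<in>off_diag n. T_perm n (\<sigma> \<circ> transpose a b))"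
proof -
  define Q where "Q = cycles n \<sigma>"
  define t where "t = (\<lambda>C::nat set. T (int (card C)))"
  define c where "c = (\<lambda>C::nat set. of_nat (card C) :: bipoly)"
  have fin: "finite Q"
    by (simp add: Q_def finite_cycles)
  have P: "T_perm n \<sigma> = prod t Q"
    by (simp add: T_perm_cycles Q_def t_def)
  have Lt: "2 * L_half (t C) * prod t (Q - {C})
    = (c C ^ 2 - 9 * c C) * prod t Q - 3 * (c C * split_sum (card C) * prod t (Q - {C}))"
    if C: "C \<in> Q" for C
  proof -
    have "finite C"
      using C finite_cycle [OF \<sigma>] by (simp add: Q_def)
    moreover have "C \<noteq> {}"
      using C unfolding Q_def cycles_def by (metis imageE orbit_nonempty)
    ultimately have "card C \<ge> 1"
      by (simp add: Suc_le_eq card_gt_0_iff)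
    then show ?thesis
      unfolding t_def L_half_T [OF \<open>card C \<ge> 1\<close>] using prod.remove [OF fin C, of t]
      by (simp add: t_def c_def algebra_simps)
  qed
  have Gt: "Gam (t C) (t D) * prod t (Q - {C} - {D}) = c C * c D * prod t Q
    - 3 * (c C * c D * T (int (card C) + int (card D)) * prod t (Q - {C} - {D}))"
    if "C \<in> Q" "D \<in> Q - {C}" for C D
  proof -
    have "prod t Q = t C * (t D * prod t (Q - {C} - {D}))"
      using prod.remove [OF fin, of C t] prod.remove [of "Q - {C}" D t] fin that by simp
    then show ?thesis
      unfolding t_def Gam_T by (simp add: c_def algebra_simps)
  qed
  have n: "sum c Q = of_nat n"
    using sum_cycle_card [OF \<sigma>] by (simp add: c_def Q_def)
  \<comment> \<open>The squares from single cycles and the products from pairs together expand the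
    square of \<open>sum c Q = of_nat n\<close>.\<close>
  have "(\<Sum>C\<in>Q. c C ^ 2 + (\<Sum>D\<in>Q - {C}. c C * c D)) = (\<Sum>C\<in>Q. c C * sum c Q)"
    by (intro sum.cong refl) (simp add: sum.remove [OF fin] sum_distrib_left distrib_left power2_eq_square)
  also have "\<dots> = of_nat n ^ 2"
    unfolding n by (simp add: n power2_eq_square flip: sum_distrib_right)
  finally have sq: "(\<Sum>C\<in>Q. c C ^ 2) + (\<Sum>C\<in>Q. \<Sum>D\<in>Q - {C}. c C * c D) = of_nat n ^ 2"
    by (simp add: sum.distrib)
  have "2 * L_half (T_perm n \<sigma>)
    = (\<Sum>C\<in>Q. (c C ^ 2 - 9 * c C) * prod t Q - 3 * (c C * split_sum (card C) * prod t (Q - {C})))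
    + (\<Sum>C\<in>Q. \<Sum>D\<in>Q - {C}. c C * c D * prod t Q
        - 3 * (c C * c D * T (int (card C) + int (card D)) * prod t (Q - {C} - {D})))"
    unfolding P L_half_prod [OF fin] by (simp add: Lt Gt)
  also have "\<dots> = ((\<Sum>C\<in>Q. c C ^ 2) + (\<Sum>C\<in>Q. \<Sum>D\<in>Q - {C}. c C * c D) - 9 * sum c Q) * prod t Q
    - 3 * ((\<Sum>C\<in>Q. c C * split_sum (card C) * prod t (Q - {C}))
      + (\<Sum>C\<in>Q. \<Sum>D\<in>Q - {C}. c C * c D * T (int (card C) + int (card D)) * prod t (Q - {C} - {D})))"
    by (simp add: sum_subtractf left_diff_distrib distrib_right distrib_left flip: sum_distrib_left sum_distrib_right)
  also have "\<dots> = (of_nat n ^ 2 - 9 * of_nat n) * T_perm n \<sigma>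
    - 3 * (\<Sum>(a, b)\<in>off_diag n. T_perm n (\<sigma> \<circ> transpose a b))"
    unfolding sum_off_diag_T_perm [OF \<sigma>] sq n P unfolding Q_def t_def c_def ..
  finally show ?thesis .
qed

lemma const_sum: "const (sum f A) = (\<Sum>x\<in>A. const (f x))"
  by (induction A rule: infinite_finite_induct) (simp_all add: const_add, simp_all add: const_def)

lemma sum_permutes_comp_transpose:
  assumes "a \<in> {1..n::nat}" "b \<in> {1..n}"
  shows "(\<Sum>\<sigma> | \<sigma> permutes {1..n}. g (\<sigma> \<circ> transpose a b)) = (\<Sum>\<sigma> | \<sigma> permutes {1..n}. g \<sigma>)"
  using permutes_comp_transpose [OF _ assms]
  by (intro sum.reindex_bij_witness [where i = "\<lambda>\<sigma>. \<sigma> \<circ> transpose a b" and j = "\<lambda>\<sigma>. \<sigma> \<circ> transpose a b"])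
    (auto simp: comp_assoc)

theorem mainTheorem6:
  fixes n :: nat and \<chi> :: "(nat \<Rightarrow> nat) \<Rightarrow> complex"
  assumes "n \<ge> 1"
    and "irreducible_character n \<chi>"
  shows "\<exists>c :: complex. L_half (F_char n \<chi>) = const c * F_char n \<chi>"
proof -
  obtain k where k: "\<And>\<sigma>. \<sigma> permutes {1..n} \<Longrightarrow>
    (\<Sum>(a, b)\<in>off_diag n. \<chi> (\<sigma> \<circ> transpose a b)) = k * \<chi> \<sigma>"
    using assms(2) by (rule character_transposition_sum) blast
  define P where "P = {\<sigma>. \<sigma> permutes {1..n}}"
  have F: "F_char n \<chi> = (\<Sum>\<sigma>\<in>P. const (\<chi> \<sigma>) * T_perm n \<sigma>)"
    by (simp add: F_char_def P_def sym_group_def)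
  \<comment> \<open>\<open>L_half_T_perm\<close> has this scalar in the polynomial ring; the
    eigenvalue needs it as a complex number.\<close>
  define m where "m = (of_nat n ^ 2 - 9 * of_nat n :: complex)"
  have m: "of_nat n ^ 2 - 9 * of_nat n = const m"
    by (simp add: m_def const_def of_nat_poly power2_eq_square numeral_poly)
  have "(\<Sum>\<sigma>\<in>P. \<Sum>(a, b)\<in>off_diag n. const (\<chi> \<sigma>) * T_perm n (\<sigma> \<circ> transpose a b))
    = (\<Sum>(a, b)\<in>off_diag n. \<Sum>\<sigma>\<in>P. const (\<chi> \<sigma>) * T_perm n (\<sigma> \<circ> transpose a b))"
    unfolding case_prod_unfold by (rule sum.swap)
  \<comment> \<open>A transposition is its own inverse, so substituting
    \<open>\<sigma> \<circ> transpose a b\<close> for \<open>\<sigma>\<close> moves it from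
    \<open>T_perm\<close> onto \<open>\<chi>\<close>.\<close>
  also have "\<dots> = (\<Sum>(a, b)\<in>off_diag n. \<Sum>\<sigma>\<in>P. const (\<chi> (\<sigma> \<circ> transpose a b)) * T_perm n \<sigma>)"
  proof (intro sum.cong refl, clarify)
    fix a b assume "(a, b) \<in> off_diag n"
    then have ab: "a \<in> {1..n}" "b \<in> {1..n}" by (auto simp: off_diag_def)
    show "(\<Sum>\<sigma>\<in>P. const (\<chi> \<sigma>) * T_perm n (\<sigma> \<circ> transpose a b))
      = (\<Sum>\<sigma>\<in>P. const (\<chi> (\<sigma> \<circ> transpose a b)) * T_perm n \<sigma>)"
      using sum_permutes_comp_transpose [OF ab, of "\<lambda>\<sigma>. const (\<chi> (\<sigma> \<circ> transpose a b)) * T_perm n \<sigma>"]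
      by (simp add: P_def comp_assoc)
  qed
  also have "\<dots> = (\<Sum>\<sigma>\<in>P. \<Sum>(a, b)\<in>off_diag n. const (\<chi> (\<sigma> \<circ> transpose a b)) * T_perm n \<sigma>)"
    unfolding case_prod_unfold by (rule sum.swap)
  also have "\<dots> = (\<Sum>\<sigma>\<in>P. const (k * \<chi> \<sigma>) * T_perm n \<sigma>)"
  proof (intro sum.cong refl)
    fix \<sigma> assume "\<sigma> \<in> P"
    then show "(\<Sum>(a, b)\<in>off_diag n. const (\<chi> (\<sigma> \<circ> transpose a b)) * T_perm n \<sigma>) = const (k * \<chi> \<sigma>) * T_perm n \<sigma>"
      by (simp add: P_def const_sum sum_distrib_right case_prod_unfold flip: k)
  qed
  also have "\<dots> = const k * F_char n \<chi>"
    by (simp add: F const_mult sum_distrib_left mult.assoc)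
  finally have swap: "(\<Sum>\<sigma>\<in>P. \<Sum>(a, b)\<in>off_diag n. const (\<chi> \<sigma>) * T_perm n (\<sigma> \<circ> transpose a b)) = const k * F_char n \<chi>" .
  have "2 * L_half (F_char n \<chi>) = (\<Sum>\<sigma>\<in>P. const (\<chi> \<sigma>) * (2 * L_half (T_perm n \<sigma>)))"
    by (simp add: F L_half_sum L_half_const_mult sum_distrib_left mult.left_commute)
  also have "\<dots> = (\<Sum>\<sigma>\<in>P. const m * (const (\<chi> \<sigma>) * T_perm n \<sigma>)
    - 3 * (\<Sum>(a, b)\<in>off_diag n. const (\<chi> \<sigma>) * T_perm n (\<sigma> \<circ> transpose a b)))"
    by (intro sum.cong refl)
      (simp add: P_def L_half_T_perm left_diff_distrib right_diff_distrib sum_distrib_left case_prod_unfold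
        mult_ac flip: m)
  also have "\<dots> = const m * F_char n \<chi> - 3 * (const k * F_char n \<chi>)"
    unfolding sum_subtractf sum_distrib_left [symmetric] swap by (simp add: F)
  \<comment> \<open>The eigenvalue joins the scalar part \<open>m\<close> with the class-sum scalar
    \<open>k\<close>; the factor 2 comes from \<open>L_half_T_perm\<close> and cancels at the
    end.\<close>
  also have "\<dots> = 2 * (const ((m - 3 * k) / 2) * F_char n \<chi>)"
  proof -
    have "2 * const ((m - 3 * k) / 2) = const m - 3 * const k"
      by (simp add: const_def numeral_poly)
    then show ?thesis
      by (simp add: left_diff_distrib flip: mult.assoc)
  qed
  finally have "L_half (F_char n \<chi>) = const ((m - 3 * k) / 2) * F_char n \<chi>"
    by simp
  then show ?thesis ..
qed

end
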